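(* Let $\mathcal{A}(\mathcal{S})$ be an LP algebra of rank $n$ and let $(\mathbf{x}_{t_1},\mathbf{F}_{t_1})$, $(\mathbf{x}_{t_2},\mathbf{F}_{t_2})$ be two LP seeds of the LP pattern $\mathcal{S}$. (1) Suppose there are a permutation $\sigma$ of $[1,n]$ and units $r_i\in R$ such that $x_{i;t_2}=r_i\,x_{\sigma(i);t_1}$ for all $i\in[1,n]$. Then for every $i\in[1,n]$ there is a unit $r'_i\in R$ such that $F_{i;t_2}=r'_i\,F_{\sigma(i);t_1}$, where each exchange polynomial $F_{j;t}$ is regarded as the element $F_{j;t}(x_{1;t},\dots,x_{n;t})$ of $\mathcal{F}$. (2) Consequently each LP seed of $\mathcal{A}(\mathcal{S})$ is uniquely determined, up to equivalence and reindexing, by its cluster.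
   Context: $R$ is a unique factorization domain containing $\mathbb{Z}$, $n\ge1$, and $\mathcal{F}$ is the field of rational functions in $n$ independent variables over $\mathrm{Frac}(R)$. For a rational function $F$, write $x_i\in F$ if $F$ involves $x_i$, and $x_i\notin F$ otherwise; $F|_{x_j\leftarrow N}$ denotes substitution of $N$ for $x_j$. An LP seed of rank $n$ is a pair $(\mathbf{x},\mathbf{F})$ where $\mathbf{x}=\{x_1,\dots,x_n\}$ (the cluster; its elements are cluster variables) is a transcendence basis of $\mathcal{F}$ over $\mathrm{Frac}(R)$, and $\mathbf{F}=\{F_1,\dots,F_n\}$ (exchange polynomials) are irreducible polynomials in $R[x_1,\dots,x_n]$ such that for all $i,j$, $x_j$ does not divide $F_i$ and $x_i\notin F_i$. The exchange Laurent polynomial is $\hat F_j=F_j/\prod_{k\neq j}x_k^{a_k}$, where $a_k\in\mathbb{Z}_{\ge0}$ is maximal such that $F_k^{a_k}$ divides $F_j|_{x_k\leftarrow F_k/x'_k}$ in $R[x_1,\dots,x_{k-1},(x'_k)^{-1},x_{k+1},\dots,x_n]$ ($x'_k$ a new indeterminate). LP mutation in direction $k$: $\mu_k(\mathbf{x},\mathbf{F})=(\mathbf{x}',\mathbf{F}')$ with $x'_k=\hat F_k/x_k$, $x'_i=x_i$ ($i\ne k$); $F'_k=F_k$; if $x_k\notin F_i$ then $F'_i=F_i$ (up to a unit of $R$); if $x_k\in F_i$, put $N_k=(\hat F_k|_{x_i\leftarrow0})/x'_k$, $G_i=F_i|_{x_k\leftarrow N_k}$, let $H_i$ be $G_i$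 with all common factors (in $R[x_1,\dots,\widehat{x_i},\dots,\widehat{x_k},\dots,x_n]$) with $\hat F_k|_{x_i\leftarrow0}$ removed, and $F'_i=MH_i$ where $M$ is a Laurent monomial in $\{x'_j\}_{j\ne i}$ with unit coefficient such that $F'_i\in R[x'_1,\dots,x'_n]$ is not divisible by any $x'_j$. The result is again an LP seed, defined up to unit factors. Two LP seeds $\Sigma_{t_1},\Sigma_{t_2}$ are equivalent if for each $i$ there are units $r_i,r'_i\in R$ with $x_{i;t_2}=r_ix_{i;t_1}$ and $F_{i;t_2}=r'_iF_{i;t_1}$; $[\Sigma]$ denotes the equivalence class, and $\mu_k[\Sigma]:=[\mu_k\Sigma]$ is well defined. An LP pattern $\mathcal{S}$ assigns an LP seed $\Sigma_t=(\mathbf{x}_t,\mathbf{F}_t)$, $\mathbf{x}_t=\{x_{1;t},\dots,x_{n;t}\}$, $\mathbf{F}_t=\{F_{1;t},\dots,F_{n;t}\}$, to each vertex $t$ of the $n$-regular tree $\mathbb{T}_n$ so that seeds at vertices joined by an edge labeled $k$ are related by $\mu_k$. The LP algebra $\mathcal{A}(\mathcal{S})$ is the $R$-subalgebra of $\mathcal{F}$ generated by all cluster variables of $\mathcal{S}$; its LP seeds are the seeds of $\mathcal{S}$. *)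

theory Defs
  imports "HOL-Library.Poly_Mapping" "HOL-Computational_Algebra.Fraction_Field"
          "HOL-Computational_Algebra.Factorial_Ring"
begin

text \<open>Polynomials in the indeterminates X_0, X_1, ... over R (variable j <-> index j;
  the rank-n variables are X_0 .. X_(n-1), i.e. the paper's x_1..x_n shifted by one).\<close>
type_synonym 'a mpoly = "(nat \<Rightarrow>\<^sub>0 nat) \<Rightarrow>\<^sub>0 'a"

definition vars :: "'a::zero mpoly \<Rightarrow> nat set" where
  "vars p = (\<Union>\<alpha>\<in>Poly_Mapping.keys p. Poly_Mapping.keys (\<alpha> :: nat \<Rightarrow>\<^sub>0 nat))"

definition in_vars :: "nat \<Rightarrow> 'a::zero mpoly \<Rightarrow> bool" where
  "in_vars n p \<longleftrightarrow> vars p \<subseteq> {..<n}"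

definition Const :: "'a::zero \<Rightarrow> 'a mpoly" where
  "Const c = Poly_Mapping.single 0 c"

definition Var :: "nat \<Rightarrow> 'a::{zero,one} mpoly" where
  "Var j = Poly_Mapping.single (Poly_Mapping.single j 1) 1"

definition monom1 :: "(nat \<Rightarrow>\<^sub>0 nat) \<Rightarrow> 'a::{zero,one} mpoly" where
  "monom1 \<alpha> = Poly_Mapping.single \<alpha> 1"

definition eval_mp :: "('a::zero \<Rightarrow> 'b::comm_semiring_1) \<Rightarrow> (nat \<Rightarrow> 'b) \<Rightarrow> 'a mpoly \<Rightarrow> 'b" where
  "eval_mp c v p = (\<Sum>\<alpha>\<in>Poly_Mapping.keys p. c (Poly_Mapping.lookup p \<alpha>) * (\<Prod>j\<in>Poly_Mapping.keys \<alpha>. v j ^ Poly_Mapping.lookup \<alpha> j))"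

definition subst_mp :: "(nat \<Rightarrow> 'a::comm_semiring_1 mpoly) \<Rightarrow> 'a mpoly \<Rightarrow> 'a mpoly" where
  "subst_mp s p = eval_mp Const s p"

type_synonym 'a ratfun = "'a mpoly fract"

definition to_fr :: "'a::{factorial_semiring,idom,ring_char_0} mpoly \<Rightarrow> 'a ratfun" where
  "to_fr p = Fract p 1"

definition ratfield :: "nat \<Rightarrow> 'a::{factorial_semiring,idom,ring_char_0} ratfun set" where
  "ratfield n = {Fract p q | p q. q \<noteq> 0 \<and> in_vars n p \<and> in_vars n q}"

definition evalF :: "(nat \<Rightarrow> 'a::{factorial_semiring,idom,ring_char_0} ratfun) \<Rightarrow> 'a mpoly \<Rightarrow> 'a ratfun" where
  "evalF x p = eval_mp (\<lambda>c. to_fr (Const c)) x p"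

text \<open>Transcendence basis of F over Frac(R): x_0..x_(n-1) lie in F, are algebraically
  independent, and every element f of F is algebraic over Frac(R)(x), i.e. P(x,f) = 0 for a
  nonzero P in R[X_0..X_n] (given independence of x, P(x,Y) \<noteq> 0 iff P \<noteq> 0;
  clearing denominators, relations over Frac(R) are the same as over R).\<close>
definition alg_indep :: "nat \<Rightarrow> (nat \<Rightarrow> 'a::{factorial_semiring,idom,ring_char_0} ratfun) \<Rightarrow> bool" where
  "alg_indep n x \<longleftrightarrow> (\<forall>p. in_vars n p \<longrightarrow> evalF x p = 0 \<longrightarrow> p = 0)"

definition trans_basis :: "nat \<Rightarrow> (nat \<Rightarrow> 'a::{factorial_semiring,idom,ring_char_0} ratfun) \<Rightarrow> bool" where
  "trans_basis n x \<longleftrightarrow>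
     (\<forall>i<n. x i \<in> ratfield n) \<and> alg_indep n x \<and>
     (\<forall>f \<in> ratfield n. \<exists>P. in_vars (Suc n) P \<and> P \<noteq> 0 \<and> evalF (x(n := f)) P = 0)"

text \<open>A seed: cluster x (indices < n) and exchange polynomials F (indices < n).\<close>
type_synonym 'a seed = "(nat \<Rightarrow> 'a ratfun) \<times> (nat \<Rightarrow> 'a mpoly)"

definition is_LP_seed :: "nat \<Rightarrow> 'a::{factorial_semiring,idom,ring_char_0} seed \<Rightarrow> bool" where
  "is_LP_seed n S \<longleftrightarrow> (let x = fst S; F = snd S in
     trans_basis n x \<and>
     (\<forall>i<n. in_vars n (F i) \<and> irreducible (F i) \<and> i \<notin> vars (F i) \<and>
            (\<forall>j<n. \<not> Var j dvd F i)))"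

text \<open>Exponent a_k in the exchange Laurent polynomial of F_j: maximal a such that
  F_k^a divides F_j with x_k replaced by F_k / x'_k in R[..., (x'_k)^(-1), ...]; the
  indeterminate (x'_k)^(-1) is represented by X_k itself (F_k does not involve X_k).\<close>
definition exch_exp :: "(nat \<Rightarrow> 'a::{factorial_semiring,idom,ring_char_0} mpoly) \<Rightarrow> nat \<Rightarrow> nat \<Rightarrow> nat" where
  "exch_exp F j k = (GREATEST a. F k ^ a dvd subst_mp (\<lambda>l. if l = k then F k * Var k else Var l) (F j))"

definition exch_den :: "nat \<Rightarrow> (nat \<Rightarrow> 'a::{factorial_semiring,idom,ring_char_0} mpoly) \<Rightarrow> nat \<Rightarrow> nat set \<Rightarrow> 'a mpoly" where
  "exch_den n F j E = (\<Prod>k\<in>{..<n} - ({j} \<union> E). Var k ^ exch_exp F j k)"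

definition hatF :: "nat \<Rightarrow> 'a::{factorial_semiring,idom,ring_char_0} seed \<Rightarrow> nat \<Rightarrow> 'a ratfun" where
  "hatF n S j = evalF (fst S) (snd S j) / evalF (fst S) (exch_den n (snd S) j {})"

definition laurent :: "nat \<Rightarrow> 'a::{factorial_semiring,idom,ring_char_0} ratfun \<Rightarrow> bool" where
  "laurent n L \<longleftrightarrow> (\<exists>p \<alpha>. in_vars n p \<and> Poly_Mapping.keys \<alpha> \<subseteq> {..<n} \<and> L = Fract p (monom1 \<alpha>))"

definition ldvd :: "nat \<Rightarrow> 'a::{factorial_semiring,idom,ring_char_0} mpoly \<Rightarrow> 'a ratfun \<Rightarrow> bool" where
  "ldvd n q L \<longleftrightarrow> (\<exists>r. laurent n r \<and> L = to_fr q * r)"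

text \<open>Non-monomial irreducible factor (monomials are units in the Laurent ring).\<close>
definition proper_factor :: "nat \<Rightarrow> 'a::{factorial_semiring,idom,ring_char_0} mpoly \<Rightarrow> bool" where
  "proper_factor n q \<longleftrightarrow> in_vars n q \<and> irreducible q \<and> (\<forall>j. \<not> q dvd Var j)"

text \<open>Formal (variable-level) computation of F'_i when x_k occurs in F_i, with the
  new variable x'_k represented by X_k and x'_j = x_j = X_j for j \<noteq> k.
  P_hat = hat F_k |_(x_i <- 0) = F_k|_(X_i<-0) / prod_(j\<noteq>k,i) X_j^(a_j);
  N_k = P_hat / X_k;  G_i = F_i |_(X_k <- N_k);  H_i = G_i with all common factors
  with P_hat removed;  F'_i = M H_i up to a unit, M a Laurent monomial not involving x'_i,
  F'_i a polynomial not divisible by any x'_j.\<close>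
definition new_exch_poly :: "nat \<Rightarrow> (nat \<Rightarrow> 'a::{factorial_semiring,idom,ring_char_0} mpoly) \<Rightarrow> nat \<Rightarrow> nat \<Rightarrow> 'a mpoly \<Rightarrow> bool" where
  "new_exch_poly n F k i F' \<longleftrightarrow>
     (let P = subst_mp (\<lambda>l. if l = i then 0 else Var l) (F k);
          Phat = to_fr P / to_fr (exch_den n F k {i});
          N = Phat / to_fr (Var k);
          G = eval_mp (\<lambda>c. to_fr (Const c)) (\<lambda>l. if l = k then N else to_fr (Var l)) (F i)
      in \<exists>D. D \<noteq> 0 \<and> in_vars n D \<and> ldvd n D G \<and>
             (\<forall>q. irreducible q \<longrightarrow> q dvd D \<longrightarrow> proper_factor n q \<and> q dvd P) \<and>
             \<not> (\<exists>q. proper_factor n q \<and> q dvd P \<and> ldvd n q (G / to_fr D)) \<and>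
             (\<exists>u \<alpha> \<beta>. is_unit u \<and> Poly_Mapping.keys \<alpha> \<subseteq> {..<n} - {i} \<and> Poly_Mapping.keys \<beta> \<subseteq> {..<n} - {i} \<and>
                 to_fr F' = to_fr (Const u) * to_fr (monom1 \<alpha>) / to_fr (monom1 \<beta>) * (G / to_fr D)) \<and>
             in_vars n F' \<and> (\<forall>j<n. \<not> Var j dvd F'))"

text \<open>S' is (a representative of) mu_k(S): the cluster is computed exactly, the
  exchange polynomials are determined up to unit factors of R.\<close>
definition LP_mutation :: "nat \<Rightarrow> nat \<Rightarrow> 'a::{factorial_semiring,idom,ring_char_0} seed \<Rightarrow> 'a seed \<Rightarrow> bool" where
  "LP_mutation n k S S' \<longleftrightarrow>
     (let x = fst S; F = snd S; x' = fst S'; F' = snd S' in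
       x' k = hatF n S k / x k \<and> (\<forall>i<n. i \<noteq> k \<longrightarrow> x' i = x i) \<and>
       (\<exists>u. is_unit u \<and> F' k = Const u * F k) \<and>
       (\<forall>i<n. i \<noteq> k \<longrightarrow>
          (k \<notin> vars (F i) \<longrightarrow> (\<exists>u. is_unit u \<and> F' i = Const u * F i)) \<and>
          (k \<in> vars (F i) \<longrightarrow> new_exch_poly n F k i (F' i))))"

text \<open>Vertices of T_n: reduced words in the labels 0..n-1 (no two equal adjacent
  letters), the root being []. The k-neighbour of t.\<close>
definition tree_vertex :: "nat \<Rightarrow> nat list \<Rightarrow> bool" where
  "tree_vertex n t \<longleftrightarrow> set t \<subseteq> {..<n} \<and> (\<forall>m. Suc m < length t \<longrightarrow> t ! m \<noteq> t ! Suc m)"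

definition tree_nbr :: "nat \<Rightarrow> nat list \<Rightarrow> nat list" where
  "tree_nbr k t = (if t \<noteq> [] \<and> last t = k then butlast t else t @ [k])"

definition LP_pattern :: "nat \<Rightarrow> (nat list \<Rightarrow> 'a::{factorial_semiring,idom,ring_char_0} seed) \<Rightarrow> bool" where
  "LP_pattern n \<Sigma> \<longleftrightarrow>
     (\<forall>t. tree_vertex n t \<longrightarrow> is_LP_seed n (\<Sigma> t)) \<and>
     (\<forall>t k. tree_vertex n t \<longrightarrow> k < n \<longrightarrow> LP_mutation n k (\<Sigma> t) (\<Sigma> (tree_nbr k t)))"

end

theory Submission
  imports Defs "HOL-Computational_Algebra.Polynomial"
begin

text \<open>
  Fix i and let F be the exchange polynomial of x_i in the first seed. Let V be the F-adic valuation
  ring of the coordinates x_l (l \<noteq> i) and x_i / F; it belongs to the divisor of zeros of F in the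
  mutated coordinate system. Its centre stays visible in every seed of the pattern: either all
  cluster variables are units of V, and V is a localization of the polynomial ring in them, or
  exactly one x_k is a nonunit and the same holds once x_k is replaced by x_k / F_k, where F_k is a
  nonunit as well. The exponents in the exchange Laurent polynomials and the substitution of x_k
  by 0 in the mutation of the exchange polynomials make this alternative invariant under mutation.
  As R[x_1, ..., x_n] is factorial, the nonunits among the polynomials without x_k are the
  multiples of F_k. Hence the exchange polynomial attached to x_i in a seed is determined, up to a
  unit, by V and the cluster.
\<close>

section \<open>Evaluation of polynomials\<close>

locale semiring_hom =
  fixes h :: "'a::comm_semiring_1 \<Rightarrow> 'b::comm_semiring_1"
  assumes hom_zero [simp]: "h 0 = 0"
    and hom_one [simp]: "h 1 = 1"
    and hom_add [simp]: "h (a + b) = h a + h b"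
    and hom_mult [simp]: "h (a * b) = h a * h b"
begin

lemma hom_power [simp]: "h (a ^ m) = h a ^ m"
  by (induction m) auto

lemma hom_sum: "h (sum f A) = (\<Sum>x\<in>A. h (f x))"
  by (induction A rule: infinite_finite_induct) auto

lemma hom_prod: "h (prod f A) = (\<Prod>x\<in>A. h (f x))"
  by (induction A rule: infinite_finite_induct) auto

lemma hom_dvd: "a dvd b \<Longrightarrow> h a dvd h b"
  by auto

end

locale ring_hom = semiring_hom h for h :: "'a::comm_ring_1 \<Rightarrow> 'b::comm_ring_1"
begin

lemma hom_uminus [simp]: "h (- a) = - h a"
  using hom_add[of a "- a"] by (simp add: add_eq_0_iff del: hom_add)

lemma hom_diff [simp]: "h (a - b) = h a - h b"
  using hom_add[of a "- b"] by (simp del: hom_add)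

end

lemma semiring_hom_comp:
  assumes "semiring_hom f" "semiring_hom g"
  shows "semiring_hom (\<lambda>x. f (g x))"
proof -
  interpret f: semiring_hom f by fact
  interpret g: semiring_hom g by fact
  show ?thesis by unfold_locales simp_all
qed

lemma semiring_hom_id: "semiring_hom (\<lambda>x. x)"
  by unfold_locales simp_all

lemma semiring_hom_const_poly: "semiring_hom (\<lambda>c. [:c:])"
  by unfold_locales (auto simp: one_pCons mult.commute)

lemma semiring_hom_poly: "semiring_hom (\<lambda>p. poly p a)"
  by unfold_locales simp_all

interpretation Const: semiring_hom "Const :: 'a::comm_semiring_1 \<Rightarrow> 'a mpoly"
  by unfold_locales (auto simp: Const_def single_add mult_single)

lemma Const_eq_iff [simp]: "Const a = Const b \<longleftrightarrow> a = b"
  by (auto simp: Const_def dest: inj_single[THEN injD])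

lemma Const_eq_0_iff [simp]: "Const a = 0 \<longleftrightarrow> a = 0"
  by (metis Const_eq_iff Const_def single_zero)

lemma monom1_neq_0 [simp]: "monom1 \<alpha> \<noteq> (0 :: 'a::zero_neq_one mpoly)"
  by (metis keys_single keys_zero monom1_def insert_not_empty one_neq_zero)

lemma Var_neq_0 [simp]: "Var j \<noteq> (0 :: 'a::zero_neq_one mpoly)"
  using monom1_neq_0[of "Poly_Mapping.single j 1"] by (simp add: Var_def monom1_def)

lemma lookup_Const_0 [simp]: "Poly_Mapping.lookup (Const a) 0 = a"
  by (simp add: Const_def)

definition monom_value :: "(nat \<Rightarrow> 'b::comm_monoid_mult) \<Rightarrow> (nat \<Rightarrow>\<^sub>0 nat) \<Rightarrow> 'b" where
  "monom_value v \<alpha> = (\<Prod>j\<in>Poly_Mapping.keys \<alpha>. v j ^ Poly_Mapping.lookup \<alpha> j)"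

lemma monom_value_zero [simp]: "monom_value v 0 = 1"
  by (simp add: monom_value_def)

lemma monom_value_single [simp]: "monom_value v (Poly_Mapping.single j m) = v j ^ m"
  by (simp add: monom_value_def)

lemma monom_value_superset:
  assumes "finite A" "Poly_Mapping.keys \<alpha> \<subseteq> A"
  shows "monom_value v \<alpha> = (\<Prod>j\<in>A. v j ^ Poly_Mapping.lookup \<alpha> j)"
  unfolding monom_value_def using assms
  by (intro prod.mono_neutral_left) (auto simp: in_keys_iff)

lemma monom_value_add: "monom_value v (\<alpha> + \<beta>) = monom_value v \<alpha> * monom_value v \<beta>"
proof -
  note superset = monom_value_superset[where A = "Poly_Mapping.keys \<alpha> \<union> Poly_Mapping.keys \<beta>"]
  show ?thesis
    using keys_add[of \<alpha> \<beta>] by (simp add: superset lookup_add power_add prod.distrib)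
qed

lemma monom_value_Var: "monom_value Var \<alpha> = (monom1 \<alpha> :: 'a::comm_semiring_1 mpoly)"
proof -
  have Var_power: "Var j ^ m = (Poly_Mapping.single (Poly_Mapping.single j m) 1 :: 'a mpoly)"
    for j m
    by (induction m) (auto simp: Var_def mult_single single_add[symmetric])
  have "(\<Prod>j\<in>A. Var j ^ f j) =
      (Poly_Mapping.single (\<Sum>j\<in>A. Poly_Mapping.single j (f j)) 1 :: 'a mpoly)" for A f
    by (induction A rule: infinite_finite_induct) (auto simp: Var_power mult_single)
  moreover have "(\<Sum>j\<in>Poly_Mapping.keys \<alpha>. Poly_Mapping.single j (Poly_Mapping.lookup \<alpha> j)) = \<alpha>"
    by (rule poly_mapping_eqI) (simp add: lookup_sum lookup_single when_def in_keys_iff)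
  ultimately show ?thesis by (simp add: monom_value_def monom1_def)
qed

lemma mpoly_sum_monomials:
  "p = (\<Sum>\<alpha>\<in>Poly_Mapping.keys p. Poly_Mapping.single \<alpha> (Poly_Mapping.lookup p \<alpha>))"
  by (rule poly_mapping_eqI) (simp add: lookup_sum lookup_single when_def in_keys_iff)

lemma eval_mp_altdef:
  "eval_mp c v p = (\<Sum>\<alpha>\<in>Poly_Mapping.keys p. c (Poly_Mapping.lookup p \<alpha>) * monom_value v \<alpha>)"
  by (simp add: eval_mp_def monom_value_def)

lemma eval_mp_cong:
  assumes "\<And>j. j \<in> vars p \<Longrightarrow> v j = v' j"
  shows "eval_mp c v p = eval_mp c v' p"
proof -
  have "v j = v' j" if "\<alpha> \<in> Poly_Mapping.keys p" "j \<in> Poly_Mapping.keys \<alpha>" for \<alpha> j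
    using assms that by (auto simp: vars_def)
  then show ?thesis by (simp add: eval_mp_def)
qed

lemma eval_mp_Const_Var [simp]: "eval_mp Const Var p = p"
  unfolding eval_mp_altdef monom_value_Var
  by (subst (3) mpoly_sum_monomials) (simp add: Const_def monom1_def mult_single)

lemma eval_mp_mem:
  assumes zero: "0 \<in> S" and one: "1 \<in> S"
    and add: "\<And>a b. a \<in> S \<Longrightarrow> b \<in> S \<Longrightarrow> a + b \<in> S"
    and mult: "\<And>a b. a \<in> S \<Longrightarrow> b \<in> S \<Longrightarrow> a * b \<in> S"
    and coeffs: "\<And>a. c a \<in> S" and vars: "\<And>j. j \<in> vars p \<Longrightarrow> v j \<in> S"
  shows "eval_mp c v p \<in> S"
proof -
  have sum: "sum f A \<in> S" if "\<And>\<alpha>. \<alpha> \<in> A \<Longrightarrow> f \<alpha> \<in> S" for f and A :: "(nat \<Rightarrow>\<^sub>0 nat) set"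
    using that by (induction A rule: infinite_finite_induct) (auto intro: zero add)
  have prod: "prod f A \<in> S" if "\<And>j. j \<in> A \<Longrightarrow> f j \<in> S" for f and A :: "nat set"
    using that by (induction A rule: infinite_finite_induct) (auto intro: one mult)
  have power: "a ^ m \<in> S" if "a \<in> S" for a and m :: nat
    using that by (induction m) (auto intro: one mult)
  show ?thesis
    unfolding eval_mp_def
    by (intro sum mult coeffs prod power vars) (auto simp: vars_def)
qed

context semiring_hom
begin

lemma hom_eval_mp: "h (eval_mp c v p) = eval_mp (\<lambda>a. h (c a)) (\<lambda>j. h (v j)) p"
  by (simp add: eval_mp_def hom_sum hom_prod)

lemma eval_mp_superset:
  assumes "finite A" "Poly_Mapping.keys p \<subseteq> A"
  shows "eval_mp h v p = (\<Sum>\<alpha>\<in>A. h (Poly_Mapping.lookup p \<alpha>) * monom_value v \<alpha>)"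
  unfolding eval_mp_altdef using assms
  by (intro sum.mono_neutral_left) (auto simp: in_keys_iff)

lemma eval_mp_single: "eval_mp h v (Poly_Mapping.single \<alpha> a) = h a * monom_value v \<alpha>"
  by (subst eval_mp_superset[where A = "{\<alpha>}"]) (auto split: if_splits)

lemma eval_mp_Const [simp]: "eval_mp h v (Const a) = h a"
  by (simp add: Const_def eval_mp_single)

lemma eval_mp_Var [simp]: "eval_mp h v (Var j) = v j"
  by (simp add: Var_def eval_mp_single)

lemma eval_mp_add: "eval_mp h v (p + q) = eval_mp h v p + eval_mp h v q"
proof -
  note superset = eval_mp_superset[where A = "Poly_Mapping.keys p \<union> Poly_Mapping.keys q"]
  show ?thesis
    using keys_add[of p q] by (simp add: superset sum.distrib lookup_add distrib_right)
qed

lemma eval_mp_sum: "eval_mp h v (sum f A) = (\<Sum>x\<in>A. eval_mp h v (f x))"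
  by (induction A rule: infinite_finite_induct) (auto simp: eval_mp_add eval_mp_def[of _ _ 0])

lemma eval_mp_mult: "eval_mp h v (p * q) = eval_mp h v p * eval_mp h v q"
proof -
  let ?t = "\<lambda>p \<alpha>. Poly_Mapping.single \<alpha> (Poly_Mapping.lookup p \<alpha>)"
  have "p * q = (\<Sum>\<alpha>\<in>Poly_Mapping.keys p. \<Sum>\<beta>\<in>Poly_Mapping.keys q. ?t p \<alpha> * ?t q \<beta>)"
    by (simp only: sum_product[symmetric] mpoly_sum_monomials[symmetric])
  then have "eval_mp h v (p * q) =
      (\<Sum>\<alpha>\<in>Poly_Mapping.keys p. \<Sum>\<beta>\<in>Poly_Mapping.keys q. eval_mp h v (?t p \<alpha> * ?t q \<beta>))"
    by (simp only: eval_mp_sum)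
  also have "\<dots> = (\<Sum>\<alpha>\<in>Poly_Mapping.keys p. \<Sum>\<beta>\<in>Poly_Mapping.keys q.
      (h (Poly_Mapping.lookup p \<alpha>) * monom_value v \<alpha>) *
      (h (Poly_Mapping.lookup q \<beta>) * monom_value v \<beta>))"
    by (simp add: mult_single eval_mp_single monom_value_add mult_ac)
  also have "\<dots> = eval_mp h v p * eval_mp h v q"
    by (simp only: eval_mp_altdef sum_product)
  finally show ?thesis .
qed

lemma semiring_hom_eval_mp: "semiring_hom (eval_mp h v)"
  using eval_mp_Const[of v 0] eval_mp_Const[of v 1]
  by unfold_locales (simp_all add: eval_mp_add eval_mp_mult del: eval_mp_Const)

end

interpretation subst_mp: semiring_hom "subst_mp s" for s
  unfolding subst_mp_def[abs_def] by (rule Const.semiring_hom_eval_mp)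

lemma subst_mp_Var [simp]: "subst_mp s (Var j) = s j"
  by (simp add: subst_mp_def)

lemma subst_mp_idem:
  assumes "\<And>j. j \<in> vars p \<Longrightarrow> s j = Var j"
  shows "subst_mp s p = p"
  using eval_mp_cong[of p s Var Const] assms by (simp add: subst_mp_def)

lemma (in semiring_hom) eval_mp_subst_mp:
  "eval_mp h v (subst_mp s p) = eval_mp h (\<lambda>j. eval_mp h v (s j)) p"
  unfolding subst_mp_def by (simp add: semiring_hom.hom_eval_mp[OF semiring_hom_eval_mp])

lemma subst_mp_subst_mp: "subst_mp s (subst_mp s' p) = subst_mp (\<lambda>j. subst_mp s (s' j)) p"
  using Const.eval_mp_subst_mp by (simp add: subst_mp_def)

section \<open>The indeterminates of a polynomial\<close>

lemma vars_zero [simp]: "vars 0 = {}"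
  by (simp add: vars_def)

lemma vars_Const [simp]: "vars (Const a) = {}"
  by (auto simp: vars_def Const_def split: if_splits)

lemma vars_one [simp]: "vars 1 = {}"
  by (simp add: vars_def)

lemma vars_Var [simp]: "vars (Var j :: 'a::zero_neq_one mpoly) = {j}"
  by (simp add: vars_def Var_def)

lemma vars_monom1: "vars (monom1 \<alpha> :: 'a::zero_neq_one mpoly) = Poly_Mapping.keys \<alpha>"
  by (simp add: monom1_def vars_def)

lemma vars_add: "vars (p + q) \<subseteq> vars p \<union> vars q"
  using keys_add[of p q] by (auto simp: vars_def)

lemma vars_diff: "vars (p - q :: 'a::ab_group_add mpoly) \<subseteq> vars p \<union> vars q"
  using vars_add[of p "- q"] by (simp add: vars_def in_keys_iff)

lemma vars_mult: "vars (p * q) \<subseteq> vars p \<union> vars q"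
proof
  fix j assume "j \<in> vars (p * q)"
  then obtain \<alpha> \<beta> where "\<alpha> \<in> Poly_Mapping.keys p" "\<beta> \<in> Poly_Mapping.keys q"
    "j \<in> Poly_Mapping.keys (\<alpha> + \<beta>)"
    using keys_mult[of p q] by (fastforce simp: vars_def)
  then show "j \<in> vars p \<union> vars q"
    using keys_add[of \<alpha> \<beta>] by (auto simp: vars_def)
qed

lemma vars_power: "vars (p ^ m) \<subseteq> vars p"
  by (induction m) (use vars_mult in fastforce)+

lemma vars_sum: "(\<And>x. x \<in> A \<Longrightarrow> vars (f x) \<subseteq> B) \<Longrightarrow> vars (sum f A) \<subseteq> B"
proof (induction A rule: infinite_finite_induct)
  case (insert x F)
  then show ?case using vars_add[of "f x" "sum f F"] by (simp add: subset_iff) blast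
qed auto

lemma vars_prod: "(\<And>x. x \<in> A \<Longrightarrow> vars (f x) \<subseteq> B) \<Longrightarrow> vars (prod f A) \<subseteq> B"
proof (induction A rule: infinite_finite_induct)
  case (insert x F)
  then show ?case using vars_mult[of "f x" "prod f F"] by (simp add: subset_iff) blast
qed auto

lemma vars_subst_mp:
  assumes "\<And>j. j \<in> vars p \<Longrightarrow> vars (s j) \<subseteq> B"
  shows "vars (subst_mp s p) \<subseteq> B"
proof -
  have "subst_mp s p \<in> {q. vars q \<subseteq> B}"
    unfolding subst_mp_def
    by (rule eval_mp_mem) (use assms vars_add vars_mult in \<open>simp_all, blast+\<close>)
  then show ?thesis by simp
qed

lemma vars_empty_imp_Const:
  assumes "vars p = {}"
  shows "p = Const (Poly_Mapping.lookup p 0)"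
proof (rule poly_mapping_eqI)
  fix \<alpha>
  have "\<alpha> = 0" if "\<alpha> \<in> Poly_Mapping.keys p"
    using assms that by (auto simp: vars_def)
  then show "Poly_Mapping.lookup p \<alpha> = Poly_Mapping.lookup (Const (Poly_Mapping.lookup p 0)) \<alpha>"
    by (cases "\<alpha> = 0") (auto simp: Const_def lookup_single when_def in_keys_iff)
qed

definition upoly :: "nat \<Rightarrow> 'a::comm_ring_1 mpoly \<Rightarrow> 'a mpoly poly" where
  "upoly k = eval_mp (\<lambda>c. [:Const c:]) (\<lambda>l. if l = k then [:0, 1:] else [:Var l:])"

lemma semiring_hom_const_upoly: "semiring_hom (\<lambda>c. [:Const c:])"
  by (rule semiring_hom_comp[OF semiring_hom_const_poly Const.semiring_hom_axioms])

interpretation upoly: ring_hom "upoly k" for k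
  unfolding upoly_def ring_hom_def
  by (rule semiring_hom.semiring_hom_eval_mp[OF semiring_hom_const_upoly])

lemma upoly_Var [simp]: "upoly k (Var k) = [:0, 1:]"
  by (simp add: upoly_def semiring_hom.eval_mp_Var[OF semiring_hom_const_upoly])

lemma poly_upoly [simp]: "poly (upoly k p) (Var k) = p"
proof -
  have "poly (upoly k p) (Var k) =
      eval_mp (\<lambda>a. poly [:Const a:] (Var k))
        (\<lambda>j. poly (if j = k then [:0, 1:] else [:Var j:]) (Var k)) p"
    unfolding upoly_def by (rule semiring_hom.hom_eval_mp[OF semiring_hom_poly])
  also have "\<dots> = eval_mp Const Var p"
    by (rule arg_cong2[where f = "\<lambda>c v. eval_mp c v p"]) auto
  finally show ?thesis by simp
qed

lemma upoly_notin_vars: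
  assumes "k \<notin> vars p"
  shows "upoly k p = [:p:]"
proof -
  have "upoly k p = eval_mp (\<lambda>c. [:Const c:]) (\<lambda>l. [:Var l:]) p"
    unfolding upoly_def using assms by (intro eval_mp_cong) auto
  also have "\<dots> = [:eval_mp Const Var p:]"
    by (rule semiring_hom.hom_eval_mp[OF semiring_hom_const_poly, symmetric])
  finally show ?thesis by simp
qed

lemma vars_coeff_upoly:
  fixes p :: "'a::comm_ring_1 mpoly"
  shows "vars (coeff (upoly k p) i) \<subseteq> vars p - {k}"
proof -
  let ?S = "{P :: 'a mpoly poly. \<forall>i. vars (coeff P i) \<subseteq> vars p - {k}}"
  have const: "[:a:] \<in> ?S" if "vars a \<subseteq> vars p - {k}" for a
    using that by (auto simp: coeff_pCons split: nat.split)
  have "upoly k p \<in> ?S"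
    unfolding upoly_def
  proof (rule eval_mp_mem)
    show "0 \<in> ?S" by simp
    show "1 \<in> ?S" unfolding one_pCons by (rule const) simp
    show "[:Const a:] \<in> ?S" for a by (rule const) simp
    show "(if j = k then [:0, 1:] else [:Var j:]) \<in> ?S" if "j \<in> vars p" for j
      using that const[of "Var j"] by (auto simp: coeff_pCons split: nat.split)
    fix P Q assume mem: "P \<in> ?S" "Q \<in> ?S"
    show "P + Q \<in> ?S"
      using mem vars_add[of "coeff P i" "coeff Q i" for i] by fastforce
    have "vars (coeff P j * coeff Q (i - j)) \<subseteq> vars p - {k}" for i j
      using mem vars_mult[of "coeff P j" "coeff Q (i - j)"] by blast
    then show "P * Q \<in> ?S" by (simp add: coeff_mult vars_sum)
  qed
  then show ?thesis by simp
qed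

lemma upoly_eq_0_iff [simp]: "upoly k p = 0 \<longleftrightarrow> p = 0"
  by (metis poly_0 poly_upoly upoly.hom_zero)

definition degree_in :: "nat \<Rightarrow> 'a::comm_ring_1 mpoly \<Rightarrow> nat" where
  "degree_in k p = Polynomial.degree (upoly k p)"

definition lead_coeff_in :: "nat \<Rightarrow> 'a::comm_ring_1 mpoly \<Rightarrow> 'a mpoly" where
  "lead_coeff_in k p = lead_coeff (upoly k p)"

lemma mpoly_expand: "p = (\<Sum>i\<le>degree_in k p. coeff (upoly k p) i * Var k ^ i)"
  using poly_altdef[of "upoly k p" "Var k"] by (simp add: degree_in_def)

lemma lead_coeff_in_eq_0_iff [simp]: "lead_coeff_in k p = 0 \<longleftrightarrow> p = 0"
  by (simp add: lead_coeff_in_def)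

lemma degree_in_eq_0_iff: "degree_in k p = 0 \<longleftrightarrow> k \<notin> vars p"
proof
  assume "degree_in k p = 0"
  then have "p = coeff (upoly k p) 0" using mpoly_expand[of p k] by simp
  then show "k \<notin> vars p" using vars_coeff_upoly[of k p 0] by auto
qed (simp add: degree_in_def upoly_notin_vars)

lemma lead_coeff_in_notin_vars: "k \<notin> vars p \<Longrightarrow> lead_coeff_in k p = p"
  by (simp add: lead_coeff_in_def upoly_notin_vars)

lemma degree_in_mult:
  fixes p q :: "'a::idom mpoly"
  shows "p \<noteq> 0 \<Longrightarrow> q \<noteq> 0 \<Longrightarrow> degree_in k (p * q) = degree_in k p + degree_in k q"
  by (simp add: degree_in_def degree_mult_eq)

lemma lead_coeff_in_mult:
  fixes p q :: "'a::idom mpoly"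
  shows "lead_coeff_in k (p * q) = lead_coeff_in k p * lead_coeff_in k q"
  by (simp add: lead_coeff_in_def lead_coeff_mult)

lemma vars_mult_eq:
  fixes p q :: "'a::idom mpoly"
  assumes "p \<noteq> 0" "q \<noteq> 0"
  shows "vars (p * q) = vars p \<union> vars q"
proof -
  have "k \<in> vars r \<longleftrightarrow> degree_in k r \<noteq> 0" for k and r :: "'a mpoly"
    by (simp add: degree_in_eq_0_iff)
  then show ?thesis by (auto simp: degree_in_mult[OF assms])
qed

lemma vars_dvd:
  fixes p q :: "'a::idom mpoly"
  shows "p dvd q \<Longrightarrow> q \<noteq> 0 \<Longrightarrow> vars p \<subseteq> vars q"
  by (auto simp: vars_mult_eq elim!: dvdE)

lemma Const_dvd_Const_iff [simp]: "Const a dvd Const b \<longleftrightarrow> a dvd b"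
  for a b :: "'a::comm_ring_1"
proof
  assume "Const a dvd Const b"
  then have "eval_mp (\<lambda>c. c) (\<lambda>_. 0) (Const a) dvd eval_mp (\<lambda>c. c) (\<lambda>_. 0) (Const b)"
    by (rule semiring_hom.hom_dvd[OF semiring_hom.semiring_hom_eval_mp[OF semiring_hom_id]])
  then show "a dvd b" by (simp add: semiring_hom.eval_mp_Const[OF semiring_hom_id])
qed (rule Const.hom_dvd)

lemma Const_dvd_1_iff [simp]: "Const a dvd 1 \<longleftrightarrow> a dvd (1 :: 'a::comm_ring_1)"
  using Const_dvd_Const_iff[of a 1] by simp

lemma is_unit_mpolyE:
  fixes p :: "'a::idom mpoly"
  assumes "p dvd 1"
  obtains u where "u dvd 1" "p = Const u"
proof -
  have "vars p = {}" using vars_dvd[OF assms] by simp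
  then obtain u where u: "p = Const u" using vars_empty_imp_Const by blast
  then show ?thesis using assms that by simp
qed

definition set_zero :: "nat \<Rightarrow> 'a::comm_ring_1 mpoly \<Rightarrow> 'a mpoly" where
  "set_zero k = subst_mp (\<lambda>l. if l = k then 0 else Var l)"

interpretation set_zero: semiring_hom "set_zero k" for k
  unfolding set_zero_def by (rule subst_mp.semiring_hom_axioms)

lemma set_zero_Var [simp]: "set_zero k (Var l) = (if l = k then 0 else Var l)"
  by (simp add: set_zero_def)

lemma set_zero_idem: "k \<notin> vars p \<Longrightarrow> set_zero k p = p"
  unfolding set_zero_def by (rule subst_mp_idem) auto

lemma vars_set_zero: "vars (set_zero k p) \<subseteq> vars p - {k}"
  unfolding set_zero_def by (rule vars_subst_mp) auto

lemma Var_dvd_diff_set_zero: "Var k dvd p - set_zero k p"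
proof -
  obtain a Q where upoly_p: "upoly k p = pCons a Q" by (cases "upoly k p") auto
  then have p: "p = a + Var k * poly Q (Var k)"
    using poly_upoly[of k p] by simp
  have "k \<notin> vars a" using vars_coeff_upoly[of k p 0] upoly_p by auto
  then have "set_zero k p = a" by (subst p) (simp add: set_zero_idem)
  then have "p - set_zero k p = Var k * poly Q (Var k)" by (subst p) simp
  then show ?thesis by simp
qed

section \<open>Unique factorization of polynomials\<close>

lemma in_vars_mono: "in_vars m p \<Longrightarrow> m \<le> m' \<Longrightarrow> in_vars m' p"
  by (auto simp: in_vars_def)

lemma in_vars_zero [simp]: "in_vars m 0"
  by (simp add: in_vars_def)

lemma in_vars_one [simp]: "in_vars m 1"
  by (simp add: in_vars_def)

lemma in_vars_Const [simp]: "in_vars m (Const a)"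
  by (simp add: in_vars_def)

lemma in_vars_Var: "l < m \<Longrightarrow> in_vars m (Var l :: 'a::zero_neq_one mpoly)"
  by (simp add: in_vars_def)

lemma in_vars_add: "in_vars m p \<Longrightarrow> in_vars m q \<Longrightarrow> in_vars m (p + q)"
  using vars_add[of p q] by (auto simp: in_vars_def)

lemma in_vars_diff: "in_vars m p \<Longrightarrow> in_vars m q \<Longrightarrow> in_vars m (p - q :: 'a::ab_group_add mpoly)"
  using vars_diff[of p q] by (auto simp: in_vars_def)

lemma in_vars_mult: "in_vars m p \<Longrightarrow> in_vars m q \<Longrightarrow> in_vars m (p * q)"
  using vars_mult[of p q] by (auto simp: in_vars_def)

lemma in_vars_power: "in_vars m p \<Longrightarrow> in_vars m (p ^ e)"
  using vars_power[of p e] by (auto simp: in_vars_def)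

lemmas in_vars_intros = in_vars_Var in_vars_add in_vars_diff in_vars_mult in_vars_power

lemma in_vars_dvd: "p dvd q \<Longrightarrow> q \<noteq> 0 \<Longrightarrow> in_vars m q \<Longrightarrow> in_vars m (p :: 'a::idom mpoly)"
  using vars_dvd[of p q] by (auto simp: in_vars_def)

lemma in_vars_multD:
  fixes p q :: "'a::idom mpoly"
  assumes "in_vars m (p * q)" "p \<noteq> 0" "q \<noteq> 0"
  shows "in_vars m p" "in_vars m q"
  using assms by (simp_all add: in_vars_def vars_mult_eq)

lemma in_vars_exists: "\<exists>m. in_vars m p"
proof -
  have "finite (vars p)" by (simp add: vars_def)
  then show ?thesis by (auto simp: in_vars_def finite_nat_iff_bounded)
qed

lemma in_vars_imp_notin_vars: "in_vars m p \<Longrightarrow> m \<notin> vars p"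
  by (auto simp: in_vars_def)

lemma in_vars_SucD: "in_vars (Suc m) p \<Longrightarrow> m \<notin> vars p \<Longrightarrow> in_vars m p"
  by (auto simp: in_vars_def less_Suc_eq)

lemma in_vars_coeff_upoly: "in_vars m p \<Longrightarrow> in_vars m (coeff (upoly k p) i)"
  using vars_coeff_upoly[of k p i] by (auto simp: in_vars_def)

lemma in_vars_coeff_upoly_Suc: "in_vars (Suc m) p \<Longrightarrow> in_vars m (coeff (upoly m p) i)"
  using vars_coeff_upoly[of m p i] by (simp add: in_vars_def lessThan_Suc) blast

lemma in_vars_lead_coeff_in: "in_vars (Suc m) p \<Longrightarrow> in_vars m (lead_coeff_in m p)"
  by (simp add: lead_coeff_in_def in_vars_coeff_upoly_Suc)

lemma in_vars_0_Const: "in_vars 0 p \<Longrightarrow> \<exists>a. p = Const a"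
  using vars_empty_imp_Const[of p] by (auto simp: in_vars_def)

fun factor_bound :: "nat \<Rightarrow> 'a::{factorial_semiring,idom} mpoly \<Rightarrow> nat" where
  "factor_bound 0 p = size (prime_factorization (Poly_Mapping.lookup p 0))"
| "factor_bound (Suc m) p = degree_in m p + factor_bound m (lead_coeff_in m p)"

lemma factor_bound_mult:
  assumes "in_vars m p" "in_vars m q" "p \<noteq> 0" "q \<noteq> 0"
  shows "factor_bound m (p * q) = factor_bound m p + factor_bound m q"
  using assms
proof (induction m arbitrary: p q)
  case 0
  then obtain a b where "p = Const a" "q = Const b" using in_vars_0_Const by blast
  with 0 show ?case by (simp flip: Const.hom_mult add: prime_factorization_mult)
next
  case (Suc m)
  then show ?case by (simp add: degree_in_mult lead_coeff_in_mult in_vars_lead_coeff_in)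
qed

lemma factor_bound_eq_0_imp_unit:
  assumes "in_vars m p" "p \<noteq> 0" "factor_bound m p = 0"
  shows "p dvd 1"
  using assms
proof (induction m arbitrary: p)
  case 0
  then obtain a where a: "p = Const a" using in_vars_0_Const by blast
  with 0 show ?case by (simp add: prime_factorization_empty_iff)
next
  case (Suc m)
  then have "m \<notin> vars p" by (simp add: degree_in_eq_0_iff)
  with Suc show ?case by (simp add: in_vars_SucD lead_coeff_in_notin_vars)
qed

lemma mpoly_factor_induct [consumes 1, case_names unit irreducible mult]:
  fixes p :: "'a::{factorial_semiring,idom} mpoly"
  assumes "p \<noteq> 0"
    and unit: "\<And>u. u dvd 1 \<Longrightarrow> P u"
    and irreducible: "\<And>q. irreducible q \<Longrightarrow> P q"
    and mult: "\<And>a b. a \<noteq> 0 \<Longrightarrow> b \<noteq> 0 \<Longrightarrow> P a \<Longrightarrow> P b \<Longrightarrow> P (a * b)"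
  shows "P p"
proof -
  obtain m where "in_vars m p" using in_vars_exists by blast
  with assms(1) show ?thesis
  proof (induction "factor_bound m p" arbitrary: p rule: less_induct)
    case less
    show ?case
    proof (cases "p dvd 1 \<or> irreducible p")
      case False
      then obtain a b where factors: "p = a * b" "\<not> a dvd 1" "\<not> b dvd 1"
        using less.prems by (auto simp: irreducible_def)
      then have nonzero: "a \<noteq> 0" "b \<noteq> 0" using less.prems by auto
      have in_vars: "in_vars m a" "in_vars m b"
        using in_vars_multD[of m a b] factors(1) nonzero less.prems by simp_all
      have "factor_bound m a \<noteq> 0" "factor_bound m b \<noteq> 0"
        using factor_bound_eq_0_imp_unit in_vars nonzero factors by blast+
      then have "factor_bound m a < factor_bound m p" "factor_bound m b < factor_bound m p"
        by (simp_all add: factors(1) factor_bound_mult[OF in_vars nonzero])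
      then have "P a" "P b" using less.hyps nonzero in_vars by blast+
      then show ?thesis unfolding factors(1) by (rule mult[OF nonzero])
    qed (auto intro: unit irreducible)
  qed
qed

definition prime_in :: "nat \<Rightarrow> 'a::comm_ring_1 mpoly \<Rightarrow> bool" where
  "prime_in m q \<longleftrightarrow> (\<forall>f g. in_vars m f \<longrightarrow> in_vars m g \<longrightarrow> q dvd f * g \<longrightarrow> q dvd f \<or> q dvd g)"

lemma prime_inD:
  "prime_in m q \<Longrightarrow> in_vars m f \<Longrightarrow> in_vars m g \<Longrightarrow> q dvd f * g \<Longrightarrow> q dvd f \<or> q dvd g"
  by (simp add: prime_in_def)

lemma irreducible_imp_prime_in_0:
  fixes q :: "'a::{factorial_semiring,idom} mpoly"
  assumes "irreducible q" "in_vars 0 q"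
  shows "prime_in 0 q"
proof -
  obtain a where a: "q = Const a" using in_vars_0_Const assms by blast
  have "irreducible a"
    unfolding irreducible_def
  proof (intro conjI allI impI)
    show "a \<noteq> 0" "\<not> is_unit a" using assms a by (auto simp: irreducible_def)
    fix b c assume "a = b * c"
    then have "q = Const b * Const c" using a by simp
    then have "Const b dvd 1 \<or> Const c dvd 1" by (rule irreducibleD[OF assms(1)])
    then show "is_unit b \<or> is_unit c" by simp
  qed
  then have "prime_elem a" by (rule irreducible_imp_prime_elem)
  then have "Const a dvd Const b \<or> Const a dvd Const c" if "Const a dvd Const b * Const c" for b c
    using that by (simp flip: Const.hom_mult add: prime_elem_dvd_mult_iff)
  then show ?thesis unfolding prime_in_def a using in_vars_0_Const by metis
qed

lemma dvd_iff_dvd_coeff_upoly: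
  fixes p q :: "'a::idom mpoly"
  assumes "k \<notin> vars q"
  shows "q dvd p \<longleftrightarrow> (\<forall>i. q dvd coeff (upoly k p) i)"
proof
  assume "q dvd p"
  then have "[:q:] dvd upoly k p"
    using upoly.hom_dvd[of q p k] assms by (simp add: upoly_notin_vars)
  then show "\<forall>i. q dvd coeff (upoly k p) i" by (simp add: const_poly_dvd_iff)
next
  assume "\<forall>i. q dvd coeff (upoly k p) i"
  then show "q dvd p" by (subst mpoly_expand[of p k]) (simp add: dvd_sum)
qed

lemma prime_in_Suc:
  fixes q :: "'a::idom mpoly"
  assumes "prime_in m q" "in_vars m q"
  shows "prime_in (Suc m) q"
  unfolding prime_in_def
proof (intro allI impI)
  fix f g assume fg: "in_vars (Suc m) f" "in_vars (Suc m) g" "q dvd f * g"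
  note dvd_iff = dvd_iff_dvd_coeff_upoly[OF in_vars_imp_notin_vars[OF assms(2)]]
  let ?f = "coeff (upoly m f)" and ?g = "coeff (upoly m g)"
  show "q dvd f \<or> q dvd g"
  proof (rule ccontr)
    assume "\<not> ?thesis"
    then have not_dvd: "\<exists>i. \<not> q dvd ?f i" "\<exists>j. \<not> q dvd ?g j"
      by (auto simp: dvd_iff[of f] dvd_iff[of g])
    define i j where "i = (LEAST i. \<not> q dvd ?f i)" and "j = (LEAST j. \<not> q dvd ?g j)"
    have i: "\<not> q dvd ?f i" and j: "\<not> q dvd ?g j"
      unfolding i_def j_def by (rule LeastI_ex[OF not_dvd(1)], rule LeastI_ex[OF not_dvd(2)])
    have below_i: "q dvd ?f l" if "l < i" for l
      using not_less_Least[OF that[unfolded i_def]] by simp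
    have below_j: "q dvd ?g l" if "l < j" for l
      using not_less_Least[OF that[unfolded j_def]] by simp
    have "q dvd (\<Sum>l\<in>{..i + j} - {i}. ?f l * ?g (i + j - l))"
    proof (rule dvd_sum)
      fix l assume "l \<in> {..i + j} - {i}"
      then have "l < i \<or> i + j - l < j" by auto
      then show "q dvd ?f l * ?g (i + j - l)" using below_i below_j by auto
    qed
    moreover have "(\<Sum>l\<le>i + j. ?f l * ?g (i + j - l)) =
        ?f i * ?g j + (\<Sum>l\<in>{..i + j} - {i}. ?f l * ?g (i + j - l))"
      by (subst sum.remove[of _ i]) simp_all
    moreover have "q dvd (\<Sum>l\<le>i + j. ?f l * ?g (i + j - l))"
      using fg(3) by (simp add: dvd_iff[of "f * g"] coeff_mult)
    ultimately have "q dvd ?f i * ?g j" by (simp add: dvd_add_left_iff)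
    then show False
      using prime_inD[OF assms(1), of "?f i" "?g j"] fg(1,2) i j
      by (simp add: in_vars_coeff_upoly_Suc)
  qed
qed

lemma degree_in_diff_less:
  assumes "degree_in k p = degree_in k q" "lead_coeff_in k p = lead_coeff_in k q" "p \<noteq> q"
  shows "degree_in k (p - q) < degree_in k p"
proof -
  have "coeff (upoly k (p - q)) (degree_in k p) = 0"
    using assms by (simp add: degree_in_def lead_coeff_in_def)
  moreover have "upoly k (p - q) \<noteq> 0" using assms(3) by (simp del: upoly.hom_diff)
  ultimately have "degree_in k (p - q) \<noteq> degree_in k p"
    by (metis degree_in_def leading_coeff_0_iff)
  moreover have "degree_in k (p - q) \<le> degree_in k p"
    using assms(1) by (simp add: degree_in_def degree_diff_le)
  ultimately show ?thesis by simp
qed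

lemma degree_in_Var_power: "degree_in k (Var k ^ e :: 'a::idom mpoly) = e"
  by (simp add: degree_in_def degree_power_eq)

lemma lead_coeff_in_Var_power: "lead_coeff_in k (Var k ^ e :: 'a::idom mpoly) = 1"
proof (induction e)
  case (Suc e)
  have "lead_coeff_in k (Var k :: 'a mpoly) = 1" by (simp add: lead_coeff_in_def)
  with Suc show ?case by (simp add: lead_coeff_in_mult)
qed (simp add: lead_coeff_in_def)

lemma cancel_leading_term:
  fixes f h :: "'a::idom mpoly"
  assumes h: "h \<noteq> 0" "in_vars (Suc m) h"
    and f: "f \<noteq> 0" "in_vars (Suc m) f" "degree_in m h \<le> degree_in m f"
  obtains a t where "in_vars m a" "a \<noteq> 0" "in_vars (Suc m) t"
    and "a * f = t * h \<or> degree_in m (a * f - t * h) < degree_in m f"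
proof -
  let ?a = "lead_coeff_in m h"
  define t where "t = lead_coeff_in m f * Var m ^ (degree_in m f - degree_in m h)"
  have a: "in_vars m ?a" "?a \<noteq> 0" and lead_f: "in_vars m (lead_coeff_in m f)"
    using h f by (simp_all add: in_vars_lead_coeff_in)
  note notin = in_vars_imp_notin_vars[OF a(1)] in_vars_imp_notin_vars[OF lead_f]
  have "degree_in m (?a * f) = degree_in m f" "degree_in m (t * h) = degree_in m f"
    using f h notin by (auto simp: t_def degree_in_mult degree_in_Var_power degree_in_eq_0_iff)
  moreover have "lead_coeff_in m (?a * f) = lead_coeff_in m (t * h)"
    using notin
    by (simp add: t_def lead_coeff_in_mult lead_coeff_in_notin_vars lead_coeff_in_Var_power
        mult.commute)
  ultimately have "?a * f = t * h \<or> degree_in m (?a * f - t * h) < degree_in m f"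
    using degree_in_diff_less[of m "?a * f" "t * h"] by auto
  moreover have "in_vars (Suc m) t"
    using lead_f unfolding t_def by (auto intro!: in_vars_intros intro: in_vars_mono)
  ultimately show ?thesis using that a by blast
qed

lemma pseudo_division:
  fixes f h :: "'a::idom mpoly"
  assumes h: "h \<noteq> 0" "in_vars (Suc m) h" and f: "in_vars (Suc m) f"
  shows "\<exists>c Q r. in_vars m c \<and> c \<noteq> 0 \<and> in_vars (Suc m) Q \<and> in_vars (Suc m) r \<and>
    c * f = Q * h + r \<and> (r = 0 \<or> degree_in m r < degree_in m h)"
  using f
proof (induction "degree_in m f" arbitrary: f rule: less_induct)
  case less
  show ?case
  proof (cases "f = 0 \<or> degree_in m f < degree_in m h")
    case True
    then show ?thesis
      using less.prems by (intro exI[of _ 1] exI[of _ 0] exI[of _ f]) auto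
  next
    case False
    then have "f \<noteq> 0" "degree_in m h \<le> degree_in m f" by simp_all
    from this(2) obtain a t where a: "in_vars m a" "a \<noteq> 0" and t: "in_vars (Suc m) t"
      and red: "a * f = t * h \<or> degree_in m (a * f - t * h) < degree_in m f"
      by (rule cancel_leading_term[OF h \<open>f \<noteq> 0\<close> less.prems])
    show ?thesis
    proof (cases "a * f = t * h")
      case True
      then show ?thesis using a t by (intro exI[of _ a] exI[of _ t] exI[of _ 0]) simp
    next
      case False
      then have less_degree: "degree_in m (a * f - t * h) < degree_in m f" using red by simp
      have "in_vars (Suc m) (a * f - t * h)"
        using h(2) less.prems a(1) t by (auto intro!: in_vars_intros intro: in_vars_mono)
      from less.hyps[OF less_degree this] obtain c Q r where IH: "in_vars m c" "c \<noteq> 0"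
        "in_vars (Suc m) Q" "in_vars (Suc m) r" "c * (a * f - t * h) = Q * h + r"
        "r = 0 \<or> degree_in m r < degree_in m h"
        by blast
      have "(c * a) * f = (Q + c * t) * h + r"
        using IH(5) by (simp add: algebra_simps)
      moreover have "in_vars (Suc m) (Q + c * t)"
        using IH t by (auto intro!: in_vars_intros intro: in_vars_mono)
      ultimately show ?thesis using IH a
        by (intro exI[of _ "c * a"] exI[of _ "Q + c * t"] exI[of _ r]) (auto intro: in_vars_mult)
    qed
  qed
qed

lemma least_degree_pseudo_dvd:
  fixes g h k p :: "'a::idom mpoly"
  assumes h: "h \<noteq> 0" "in_vars (Suc m) h" "p dvd h * g"
    and least: "\<And>h'. h' \<noteq> 0 \<Longrightarrow> in_vars (Suc m) h' \<Longrightarrow> p dvd h' * g \<Longrightarrow> degree_in m h \<le> degree_in m h'"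
    and k: "in_vars (Suc m) k" "p dvd k * g"
  obtains c Q where "c \<noteq> 0" "in_vars m c" "in_vars (Suc m) Q" "c * k = Q * h"
proof -
  obtain c Q r where remainder: "in_vars m c" "c \<noteq> 0" "in_vars (Suc m) Q" "in_vars (Suc m) r"
    "c * k = Q * h + r" "r = 0 \<or> degree_in m r < degree_in m h"
    using pseudo_division[OF h(1,2) k(1)] by blast
  have "r * g = c * (k * g) - Q * (h * g)"
    using arg_cong[OF remainder(5), of "\<lambda>t. t * g"] by (simp add: algebra_simps)
  then have "p dvd r * g" using h(3) k(2) by simp
  then have "r = 0" using least[of r] remainder(4,6) by (cases "r = 0") auto
  then show ?thesis using that remainder by simp
qed

context
  fixes m :: nat and type :: "'a::{factorial_semiring,idom} itself"
  assumes irreducible_imp_prime_in: "\<And>q :: 'a mpoly. irreducible q \<Longrightarrow> in_vars m q \<Longrightarrow> prime_in m q"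
begin

lemma split_irreducible_coefficient:
  fixes q k f g :: "'a mpoly"
  assumes "irreducible q" "in_vars m q" "in_vars (Suc m) f" "in_vars (Suc m) g" "q * k = f * g"
  obtains (left) f' where "f = q * f'" "k = f' * g" | (right) g' where "g = q * g'" "k = f * g'"
proof -
  have "q dvd f * g" using assms(5) by (metis dvd_triv_left)
  then have "q dvd f \<or> q dvd g"
    using prime_inD[OF prime_in_Suc[OF irreducible_imp_prime_in[OF assms(1,2)] assms(2)] assms(3,4)]
    by blast
  moreover have q: "q \<noteq> 0" using assms(1) by auto
  ultimately consider (left) f' where "f = q * f'" | (right) g' where "g = q * g'"
    by (auto elim!: dvdE)
  then show ?thesis
  proof cases
    case (left f')
    then have "q * k = q * (f' * g)" using assms(5) by (simp only: mult.assoc)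
    then show ?thesis using left q that(1) by simp
  next
    case (right g')
    then have "q * k = q * (f * g')" using assms(5) by (simp only: mult.left_commute)
    then show ?thesis using right q that(2) by simp
  qed
qed

lemma split_coefficient:
  fixes c k f g :: "'a mpoly"
  assumes "c \<noteq> 0" "k \<noteq> 0" "in_vars m c" "in_vars (Suc m) f" "in_vars (Suc m) g" "c * k = f * g"
  shows "\<exists>c\<^sub>1 c\<^sub>2 f' g'. in_vars m c\<^sub>1 \<and> in_vars m c\<^sub>2 \<and> f = c\<^sub>1 * f' \<and> g = c\<^sub>2 * g' \<and> k = f' * g'"
  using assms
proof (induction c arbitrary: f g k rule: mpoly_factor_induct)
  case (unit u)
  obtain v where v: "u * v = 1" using unit.hyps by (metis dvdE)
  have "k = f * (v * g)" using unit.prems(5) v by algebra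
  moreover have "g = u * (v * g)" by (simp only: mult.assoc[symmetric] v mult_1_left)
  ultimately show ?case
    using unit.prems(2)
    by (intro exI[of _ 1] exI[of _ u] exI[of _ f] exI[of _ "v * g"] conjI
        in_vars_one mult_1_left[symmetric])
next
  case (irreducible q)
  from irreducible.hyps irreducible.prems(2-5) show ?case
  proof (cases rule: split_irreducible_coefficient)
    case (left f')
    then show ?thesis
      using irreducible.prems by (intro exI[of _ q] exI[of _ 1] exI[of _ f'] exI[of _ g]) simp
  next
    case (right g')
    then show ?thesis
      using irreducible.prems by (intro exI[of _ 1] exI[of _ q] exI[of _ f] exI[of _ g']) simp
  qed
next
  case (mult a b)
  have in_vars: "in_vars m a" "in_vars m b" using in_vars_multD[OF mult.prems(2)] mult.hyps by auto
  have nonzero: "f \<noteq> 0" "g \<noteq> 0" using mult.hyps mult.prems by auto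
  obtain c\<^sub>1 c\<^sub>2 f' g' where
    split_a: "in_vars m c\<^sub>1" "in_vars m c\<^sub>2" "f = c\<^sub>1 * f'" "g = c\<^sub>2 * g'" "b * k = f' * g'"
    using mult.IH(1)[of "b * k" f g] mult.hyps mult.prems in_vars by (auto simp: mult.assoc)
  then have "in_vars (Suc m) f'" "in_vars (Suc m) g'"
    using in_vars_dvd[of f' f] in_vars_dvd[of g' g] nonzero mult.prems by auto
  then obtain d\<^sub>1 d\<^sub>2 f'' g'' where
    split_b: "in_vars m d\<^sub>1" "in_vars m d\<^sub>2" "f' = d\<^sub>1 * f''" "g' = d\<^sub>2 * g''" "k = f'' * g''"
    using mult.IH(2)[of k f' g'] mult.prems in_vars split_a(5) by auto
  have "f = (c\<^sub>1 * d\<^sub>1) * f''" "g = (c\<^sub>2 * d\<^sub>2) * g''"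
    using split_a(3,4) split_b(3,4) by (simp_all only: mult.assoc)
  moreover have "in_vars m (c\<^sub>1 * d\<^sub>1)" "in_vars m (c\<^sub>2 * d\<^sub>2)"
    using split_a(1,2) split_b(1,2) by (simp_all only: in_vars_mult)
  ultimately show ?case using split_b(5) by blast
qed

lemma cancel_coefficient:
  fixes p :: "'a mpoly"
  assumes p: "irreducible p" "in_vars (Suc m) p" "\<not> in_vars m p"
    and c: "c \<noteq> 0" "in_vars m c" and f: "in_vars (Suc m) f" and dvd: "p dvd c * f"
  shows "p dvd f"
proof (cases "f = 0")
  case False
  obtain s where s: "c * f = p * s" using dvd by (elim dvdE)
  have "in_vars (Suc m) (p * s)" "p * s \<noteq> 0"
    unfolding s[symmetric] using c f False in_vars_mono[OF c(2), of "Suc m"]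
    by (simp_all add: in_vars_mult)
  then have "in_vars (Suc m) s" by (auto intro: in_vars_multD(2))
  then obtain c\<^sub>1 c\<^sub>2 p' s' where factors: "in_vars m c\<^sub>1" "p = c\<^sub>1 * p'" "f = p' * s'"
    using split_coefficient[OF c(1) False c(2) p(2) _ s] by metis
  have "\<not> p' dvd 1"
    using p(3) factors in_vars_dvd[of p' 1 m] by (auto intro: in_vars_mult)
  then have "c\<^sub>1 dvd 1" using irreducibleD[OF p(1) factors(2)] by simp
  then have "p dvd p'" using mult_dvd_mono[of c\<^sub>1 1 p' p'] by (simp add: factors(2))
  then show ?thesis using factors(3) by simp
qed simp

text \<open>The polynomials h with p dvd h * g form an ideal. Up to coefficients it is generated by an
  element h of least degree, and such an h divides p.\<close>

lemma irreducible_imp_prime_in_Suc: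
  fixes p :: "'a mpoly"
  assumes p: "irreducible p" "in_vars (Suc m) p" "\<not> in_vars m p"
  shows "prime_in (Suc m) p"
  unfolding prime_in_def
proof (intro allI impI)
  fix f g assume fg: "in_vars (Suc m) f" "in_vars (Suc m) g" "p dvd f * g"
  have p_nonzero: "p \<noteq> 0" using p(1) by auto
  let ?J = "\<lambda>h. h \<noteq> 0 \<and> in_vars (Suc m) h \<and> p dvd h * g"
  have "?J p" using p p_nonzero by simp
  then obtain h where h: "?J h" and least: "\<And>h'. ?J h' \<Longrightarrow> degree_in m h \<le> degree_in m h'"
    using ex_has_least_nat[of ?J p "degree_in m"] by blast
  obtain c Q where "c \<noteq> 0" "in_vars m c" "in_vars (Suc m) Q" "c * p = Q * h"
    by (rule least_degree_pseudo_dvd[of h m p g p]) (use h least p(2) in auto)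
  then obtain c\<^sub>2 Q' h' where factors: "in_vars m c\<^sub>2" "h = c\<^sub>2 * h'" "p = Q' * h'"
    using split_coefficient[of c p Q h] h p_nonzero by metis
  consider "Q' dvd 1" | "h' dvd 1" using irreducibleD[OF p(1) factors(3)] by blast
  then show "p dvd f \<or> p dvd g"
  proof cases
    case 1
    then have "p dvd h'" using mult_dvd_mono[of Q' 1 h' h'] by (simp add: factors(3))
    then have "p dvd h" by (simp add: factors(2))
    obtain c Q where c: "c \<noteq> 0" "in_vars m c" "in_vars (Suc m) Q" "c * f = Q * h"
      by (rule least_degree_pseudo_dvd[of h m p g f]) (use h least fg in auto)
    then have "p dvd c * f" using \<open>p dvd h\<close> by simp
    then show ?thesis using cancel_coefficient[OF p c(1,2) fg(1)] by simp
  next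
    case 2
    then have "h * g dvd c\<^sub>2 * g"
      using mult_dvd_mono[of h' 1 "c\<^sub>2 * g" "c\<^sub>2 * g"] by (simp add: factors(2) mult_ac)
    then have "p dvd c\<^sub>2 * g" using h dvd_trans by blast
    moreover have "c\<^sub>2 \<noteq> 0" using h factors by auto
    ultimately show ?thesis using cancel_coefficient[OF p _ factors(1) fg(2)] by simp
  qed
qed

end

lemma irreducible_imp_prime_in:
  fixes p :: "'a::{factorial_semiring,idom} mpoly"
  assumes "irreducible p" "in_vars m p"
  shows "prime_in m p"
  using assms
proof (induction m arbitrary: p)
  case 0
  then show ?case by (rule irreducible_imp_prime_in_0)
next
  case (Suc m)
  then show ?case
    by (cases "in_vars m p") (auto intro: prime_in_Suc irreducible_imp_prime_in_Suc)
qed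

lemma irreducible_imp_prime_elem_mpoly:
  fixes p :: "'a::{factorial_semiring,idom} mpoly"
  assumes "irreducible p"
  shows "prime_elem p"
proof (rule prime_elemI)
  show "p \<noteq> 0" "\<not> p dvd 1" using assms by (auto simp: irreducible_def)
  fix f g assume dvd: "p dvd f * g"
  obtain m\<^sub>1 m\<^sub>2 m\<^sub>3 where "in_vars m\<^sub>1 p" "in_vars m\<^sub>2 f" "in_vars m\<^sub>3 g"
    using in_vars_exists by metis
  then have "in_vars (max m\<^sub>1 (max m\<^sub>2 m\<^sub>3)) p" "in_vars (max m\<^sub>1 (max m\<^sub>2 m\<^sub>3)) f"
    "in_vars (max m\<^sub>1 (max m\<^sub>2 m\<^sub>3)) g"
    by (auto intro: in_vars_mono)
  then show "p dvd f \<or> p dvd g"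
    using prime_inD[OF irreducible_imp_prime_in[OF assms]] dvd by blast
qed

lemma irreducible_dvd_irreducible:
  fixes p q :: "'a::idom mpoly"
  assumes "irreducible p" "irreducible q" "q dvd p"
  shows "p dvd q"
proof -
  obtain s where cofactor: "p = q * s" using assms(3) by (elim dvdE)
  then have "s dvd 1" using assms(1,2) by (auto simp: irreducible_def)
  then show ?thesis using cofactor mult_dvd_mono[of q q s 1] by simp
qed

lemma prime_power_decomposition:
  fixes p q :: "'a::{factorial_semiring,idom} mpoly"
  assumes "p \<noteq> 0" "irreducible q"
  obtains a p' where "p = q ^ a * p'" "\<not> q dvd p'"
proof -
  have q: "prime_elem q" "\<not> q dvd 1"
    using assms(2) by (auto simp: irreducible_imp_prime_elem_mpoly irreducible_def)
  from assms(1) have "\<exists>a p'. p = q ^ a * p' \<and> \<not> q dvd p'"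
  proof (induction p rule: mpoly_factor_induct)
    case (unit u)
    then have "\<not> q dvd u" using q(2) dvd_trans by blast
    then show ?case by (intro exI[of _ 0] exI[of _ u]) simp
  next
    case (irreducible r)
    show ?case
    proof (cases "q dvd r")
      case True
      then obtain s where s: "r = q * s" by (elim dvdE)
      then have "s dvd 1" using irreducibleD[OF irreducible s] q(2) by simp
      then have "\<not> q dvd s" using q(2) dvd_trans by blast
      then show ?thesis using s by (intro exI[of _ 1] exI[of _ s]) simp
    next
      case False
      then show ?thesis by (intro exI[of _ 0] exI[of _ r]) simp
    qed
  next
    case (mult a b)
    then obtain i a' j b' where "a = q ^ i * a'" "\<not> q dvd a'" "b = q ^ j * b'" "\<not> q dvd b'" by blast
    then show ?case
      using q(1) by (intro exI[of _ "i + j"] exI[of _ "a' * b'"])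
        (simp add: prime_elem_dvd_mult_iff power_add mult_ac)
  qed
  then show ?thesis using that by blast
qed

lemma Greatest_power_dvd:
  fixes q :: "'a::idom"
  assumes "q \<noteq> 0" "\<not> q dvd p'"
  shows "(GREATEST e. q ^ e dvd q ^ a * p') = a"
proof (rule Greatest_equality)
  fix e assume dvd: "q ^ e dvd q ^ a * p'"
  show "e \<le> a"
  proof (rule ccontr)
    assume "\<not> e \<le> a"
    then have "q ^ Suc a dvd q ^ a * p'"
      using dvd by (meson dvd_trans le_imp_power_dvd not_less_eq_eq)
    then have "q ^ a * q dvd q ^ a * p'" by (simp add: mult.commute)
    then show False using assms by simp
  qed
qed simp

lemma vars_subset_if_irreducible_factors_dvd:
  fixes p q :: "'a::{factorial_semiring,idom} mpoly"
  assumes "p \<noteq> 0" "q \<noteq> 0" "\<And>r. irreducible r \<Longrightarrow> r dvd p \<Longrightarrow> r dvd q"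
  shows "vars p \<subseteq> vars q"
  using assms(1,3)
proof (induction p rule: mpoly_factor_induct)
  case (unit u)
  then show ?case by (auto elim: is_unit_mpolyE)
next
  case (irreducible r)
  then show ?case using vars_dvd[OF _ assms(2)] by simp
next
  case (mult a b)
  then have "vars a \<subseteq> vars q" "vars b \<subseteq> vars q" by (meson dvd_mult dvd_mult2)+
  then show ?case using vars_mult[of a b] by blast
qed

lemma irreducible_not_dvd_Var:
  fixes p :: "'a::idom mpoly"
  assumes p: "irreducible p" and "\<not> Var l dvd p"
  shows "\<not> p dvd Var l"
proof
  have Var_dvd: "Var l dvd q" if "set_zero l q = 0" for q :: "'a mpoly"
    using Var_dvd_diff_set_zero[of l q] that by simp
  assume "p dvd Var l"
  then obtain h where h: "Var l = p * h" by (elim dvdE)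
  have "set_zero l p * set_zero l h = 0" by (simp flip: set_zero.hom_mult h)
  then have "Var l dvd h" using Var_dvd assms(2) by auto
  then obtain h' where h': "h = Var l * h'" by (elim dvdE)
  have "Var l * 1 = p * h" using h by simp
  also have "\<dots> = Var l * (p * h')" by (simp only: h' mult_ac)
  finally have "1 = p * h'" unfolding mult_cancel_left by simp
  then show False using p by (metis dvd_triv_left irreducible_def)
qed

section \<open>Clearing denominators in one variable\<close>

definition homogenize :: "nat \<Rightarrow> 'a::comm_ring_1 mpoly \<Rightarrow> 'a mpoly \<Rightarrow> 'a mpoly \<Rightarrow> 'a mpoly" where
  "homogenize k p a b = (\<Sum>i\<le>degree_in k p. coeff (upoly k p) i * a ^ i * b ^ (degree_in k p - i))"

lemma in_vars_homogenize:
  assumes "in_vars n p" "in_vars n a" "in_vars n b"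
  shows "in_vars n (homogenize k p a b)"
proof -
  have "in_vars n (coeff (upoly k p) i * a ^ i * b ^ j)" for i j
    using assms by (intro in_vars_mult in_vars_power in_vars_coeff_upoly)
  then show ?thesis by (simp add: homogenize_def in_vars_def vars_sum)
qed

lemma homogenize_mult_Var: "homogenize k p (b * Var k) b = b ^ degree_in k p * p"
proof -
  have "homogenize k p (b * Var k) b =
      (\<Sum>i\<le>degree_in k p. b ^ degree_in k p * (coeff (upoly k p) i * Var k ^ i))"
    unfolding homogenize_def
  proof (rule sum.cong[OF refl])
    fix i assume "i \<in> {..degree_in k p}"
    then have "b ^ degree_in k p = b ^ i * b ^ (degree_in k p - i)" by (simp flip: power_add)
    then show "coeff (upoly k p) i * (b * Var k) ^ i * b ^ (degree_in k p - i) =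
        b ^ degree_in k p * (coeff (upoly k p) i * Var k ^ i)"
      by (simp add: power_mult_distrib mult_ac)
  qed
  also have "\<dots> = b ^ degree_in k p * p"
    by (simp flip: sum_distrib_left mpoly_expand)
  finally show ?thesis .
qed

lemma homogenize_diff_dvd:
  assumes "t dvd b - b'"
  shows "t dvd homogenize k p a b - homogenize k p a b'"
proof -
  have "b - b' dvd b ^ e - b' ^ e" for e by (simp add: power_diff_sumr2)
  then have "t dvd coeff (upoly k p) i * a ^ i * (b ^ e - b' ^ e)" for i e
    using assms dvd_trans by (intro dvd_mult) blast
  then show ?thesis
    unfolding homogenize_def sum_subtractf[symmetric] right_diff_distrib[symmetric]
    by (intro dvd_sum) blast
qed

lemma subst_mp_homogenize:
  assumes "\<And>l. l \<noteq> k \<Longrightarrow> s l = Var l"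
  shows "subst_mp s (homogenize k p a b) = homogenize k p (subst_mp s a) (subst_mp s b)"
proof -
  have "subst_mp s (coeff (upoly k p) i) = coeff (upoly k p) i" for i
    using vars_coeff_upoly[of k p i] by (intro subst_mp_idem assms) auto
  then show ?thesis by (simp add: homogenize_def subst_mp.hom_sum)
qed

definition scale_var :: "nat \<Rightarrow> 'a::comm_ring_1 mpoly \<Rightarrow> 'a mpoly \<Rightarrow> 'a mpoly" where
  "scale_var k f = subst_mp (\<lambda>l. if l = k then f * Var k else Var l)"

interpretation scale_var: semiring_hom "scale_var k f" for k f
  unfolding scale_var_def by (rule subst_mp.semiring_hom_axioms)

lemma scale_var_idem: "k \<notin> vars p \<Longrightarrow> scale_var k f p = p"
  unfolding scale_var_def by (rule subst_mp_idem) auto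

lemma vars_scale_var: "vars (scale_var k f p) \<subseteq> vars p \<union> vars f"
  unfolding scale_var_def
proof (rule vars_subst_mp)
  fix l assume "l \<in> vars p"
  then show "vars (if l = k then f * Var k else Var l) \<subseteq> vars p \<union> vars f"
    using vars_mult[of f "Var k"] by auto
qed

lemma set_zero_scale_var: "set_zero k (scale_var k f p) = set_zero k p"
  unfolding scale_var_def set_zero_def subst_mp_subst_mp
  by (rule arg_cong[where f = "\<lambda>s. subst_mp s p"]) auto

lemma scale_var_homogenize:
  assumes "k \<notin> vars f"
  shows "scale_var k f (homogenize k p (Var k) f) = f ^ degree_in k p * p"
proof -
  have "scale_var k f (homogenize k p (Var k) f) = homogenize k p (f * Var k) (scale_var k f f)"
    unfolding scale_var_def by (simp add: subst_mp_homogenize)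
  then show ?thesis by (simp add: scale_var_idem[OF assms] homogenize_mult_Var)
qed

section \<open>Subalgebras of the field of rational functions\<close>

interpretation to_fr: ring_hom to_fr
  by unfold_locales (simp_all add: to_fr_def fract_collapse)

lemma to_fr_eq_iff [simp]: "to_fr p = to_fr q \<longleftrightarrow> p = q"
  by (simp add: to_fr_def eq_fract)

lemma to_fr_eq_0_iff [simp]: "to_fr p = 0 \<longleftrightarrow> p = 0"
  using to_fr_eq_iff[of p 0] by (simp del: to_fr_eq_iff)

lemma semiring_hom_to_fr_Const: "semiring_hom (\<lambda>c. to_fr (Const c))"
  by (rule semiring_hom_comp[OF to_fr.semiring_hom_axioms Const.semiring_hom_axioms])

interpretation evalF: ring_hom "evalF x" for x
  unfolding evalF_def[abs_def] ring_hom_def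
  by (rule semiring_hom.semiring_hom_eval_mp[OF semiring_hom_to_fr_Const])

lemma evalF_Var [simp]: "evalF x (Var j) = x j"
  by (simp add: evalF_def semiring_hom.eval_mp_Var[OF semiring_hom_to_fr_Const])

lemma evalF_Const [simp]: "evalF x (Const c) = to_fr (Const c)"
  by (simp add: evalF_def semiring_hom.eval_mp_Const[OF semiring_hom_to_fr_Const])

lemma evalF_monom1: "evalF x (monom1 \<alpha>) = monom_value x \<alpha>"
  by (simp add: evalF_def monom1_def semiring_hom.eval_mp_single[OF semiring_hom_to_fr_Const])

lemma evalF_cong: "(\<And>j. j \<in> vars p \<Longrightarrow> x j = y j) \<Longrightarrow> evalF x p = evalF y p"
  unfolding evalF_def by (rule eval_mp_cong)

lemma evalF_subst_mp: "evalF x (subst_mp s p) = evalF (\<lambda>j. evalF x (s j)) p"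
  unfolding evalF_def by (rule semiring_hom.eval_mp_subst_mp[OF semiring_hom_to_fr_Const])

lemma evalF_to_fr_Var: "evalF (\<lambda>l. to_fr (Var l)) p = to_fr p"
  using to_fr.hom_eval_mp[of Const Var p] by (simp add: evalF_def)

lemma evalF_homogenize:
  assumes "evalF x b \<noteq> 0"
  shows "evalF x (homogenize k p a b) =
    evalF x b ^ degree_in k p * evalF (x(k := evalF x a / evalF x b)) p"
proof -
  let ?N = "degree_in k p" and ?c = "coeff (upoly k p)" and ?x = "x(k := evalF x a / evalF x b)"
  have "evalF ?x p = (\<Sum>i\<le>?N. evalF ?x (?c i) * (evalF x a / evalF x b) ^ i)"
    by (subst mpoly_expand[of p k]) (simp add: evalF.hom_sum)
  moreover have "evalF ?x (?c i) = evalF x (?c i)" for i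
    using vars_coeff_upoly[of k p i] by (intro evalF_cong) auto
  ultimately have "evalF x b ^ ?N * evalF ?x p =
      (\<Sum>i\<le>?N. evalF x b ^ ?N * (evalF x (?c i) * (evalF x a / evalF x b) ^ i))"
    by (simp only: sum_distrib_left)
  also have "\<dots> = (\<Sum>i\<le>?N. evalF x (?c i * a ^ i * b ^ (?N - i)))"
  proof (rule sum.cong[OF refl])
    fix i assume "i \<in> {..?N}"
    then have "evalF x b ^ ?N = evalF x b ^ i * evalF x b ^ (?N - i)"
      by (simp flip: power_add)
    then show "evalF x b ^ ?N * (evalF x (?c i) * (evalF x a / evalF x b) ^ i) =
        evalF x (?c i * a ^ i * b ^ (?N - i))"
      using assms by (simp add: power_divide)
  qed
  finally show ?thesis by (simp only: homogenize_def evalF.hom_sum)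
qed

lemma alg_indep_evalF_eq_0_iff: "alg_indep n x \<Longrightarrow> in_vars n p \<Longrightarrow> evalF x p = 0 \<longleftrightarrow> p = 0"
  by (auto simp: alg_indep_def)

lemma alg_indep_evalF_eq_iff:
  "alg_indep n x \<Longrightarrow> in_vars n p \<Longrightarrow> in_vars n q \<Longrightarrow> evalF x p = evalF x q \<longleftrightarrow> p = q"
  using alg_indep_evalF_eq_0_iff[of n x "p - q"] by (simp add: in_vars_diff)

text \<open>In algebraic geometry: a chart of the blow-up of the locus where both x k and f vanish.\<close>

definition blowup ::
  "nat \<Rightarrow> 'a::{factorial_semiring,idom,ring_char_0} mpoly \<Rightarrow> (nat \<Rightarrow> 'a ratfun) \<Rightarrow>
    nat \<Rightarrow> 'a ratfun" where
  "blowup k f x = x(k := x k / evalF x f)"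

lemma evalF_blowup: "k \<notin> vars p \<Longrightarrow> evalF (blowup k f x) p = evalF x p"
  by (rule evalF_cong) (auto simp: blowup_def)

lemma evalF_blowup_scale_var:
  assumes "k \<notin> vars f" "evalF x f \<noteq> 0"
  shows "evalF (blowup k f x) (scale_var k f p) = evalF x p"
  unfolding scale_var_def evalF_subst_mp
  by (rule evalF_cong) (use assms in \<open>simp add: evalF_blowup, simp add: blowup_def\<close>)

lemma alg_indep_blowup:
  assumes x: "alg_indep n x" and k: "k < n" and f: "f \<noteq> 0" "in_vars n f" "k \<notin> vars f"
  shows "alg_indep n (blowup k f x)"
  unfolding alg_indep_def
proof (intro allI impI)
  fix p assume p: "in_vars n p" "evalF (blowup k f x) p = 0"
  let ?h = "homogenize k p (Var k) f"
  have "evalF x ?h = 0"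
    using p(2) alg_indep_evalF_eq_0_iff[OF x f(2)] f(1) by (simp add: evalF_homogenize blowup_def)
  then have "?h = 0"
    using alg_indep_evalF_eq_0_iff[OF x] p(1) f(2) k by (simp add: in_vars_homogenize in_vars_Var)
  then have "f ^ degree_in k p * p = 0" using scale_var_homogenize[OF f(3), of p] by simp
  then show "p = 0" using f(1) by simp
qed

definition units :: "'b::field set \<Rightarrow> 'b set" where
  "units V = {f \<in> V. f \<noteq> 0 \<and> inverse f \<in> V}"

locale subalgebra =
  fixes S :: "'a::{factorial_semiring,idom,ring_char_0} ratfun set"
  assumes const_mem: "to_fr (Const c) \<in> S"
    and add_mem: "f \<in> S \<Longrightarrow> g \<in> S \<Longrightarrow> f + g \<in> S"
    and mult_mem: "f \<in> S \<Longrightarrow> g \<in> S \<Longrightarrow> f * g \<in> S"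
begin

lemma zero_mem: "0 \<in> S"
  using const_mem[of 0] by simp

lemma one_mem: "1 \<in> S"
  using const_mem[of 1] by simp

lemma diff_mem:
  assumes "f \<in> S" "g \<in> S"
  shows "f - g \<in> S"
proof -
  have "to_fr (Const (- 1 :: 'a)) = - 1"
    using ring_hom.hom_uminus[OF ring_hom.intro[OF semiring_hom_to_fr_Const], of 1] by simp
  then have eq: "f - g = f + to_fr (Const (- 1)) * g" by simp
  show ?thesis unfolding eq by (intro add_mem mult_mem const_mem assms)
qed

lemma power_mem: "f \<in> S \<Longrightarrow> f ^ e \<in> S"
  by (induction e) (auto intro: one_mem mult_mem)

lemma evalF_mem: "(\<And>l. l \<in> vars p \<Longrightarrow> x l \<in> S) \<Longrightarrow> evalF x p \<in> S"
  unfolding evalF_def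
  by (rule eval_mp_mem) (auto intro: zero_mem one_mem add_mem mult_mem const_mem)

lemma units_subset: "f \<in> units S \<Longrightarrow> f \<in> S"
  by (simp add: units_def)

lemma units_nonzero: "f \<in> units S \<Longrightarrow> f \<noteq> 0"
  by (simp add: units_def)

lemma units_one: "1 \<in> units S"
  by (simp add: units_def one_mem)

lemma units_mult: "f \<in> units S \<Longrightarrow> g \<in> units S \<Longrightarrow> f * g \<in> units S"
  by (simp add: units_def mult_mem)

lemma units_divide: "f \<in> units S \<Longrightarrow> g \<in> units S \<Longrightarrow> f / g \<in> units S"
  by (simp add: units_def divide_inverse mult_mem)

lemma divide_units_mem: "f \<in> S \<Longrightarrow> g \<in> units S \<Longrightarrow> f / g \<in> S"
  by (simp add: units_def divide_inverse mult_mem)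

lemma units_multD:
  assumes "f \<in> S" "g \<in> S" "f * g \<in> units S"
  shows "f \<in> units S"
proof -
  have "inverse f = g * inverse (f * g)" using assms(3) by (auto simp: units_def)
  also have "\<dots> \<in> S" using assms by (auto simp: units_def intro: mult_mem)
  finally show ?thesis using assms by (auto simp: units_def)
qed

lemma units_mult_cancel:
  assumes "u \<in> units S"
  shows "u * f \<in> units S \<longleftrightarrow> f \<in> units S"
  using units_mult[OF assms, of f] units_divide[OF _ assms, of "u * f"] units_nonzero[OF assms]
  by auto

lemma units_power: "f \<in> units S \<Longrightarrow> f ^ e \<in> units S"
  by (induction e) (auto intro: units_one units_mult)

lemma units_prod: "(\<And>i. i \<in> A \<Longrightarrow> f i \<in> units S) \<Longrightarrow> prod f A \<in> units S"
  by (induction A rule: infinite_finite_induct) (auto intro: units_one units_mult)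

lemma units_const:
  assumes "u dvd 1"
  shows "to_fr (Const u) \<in> units S"
proof -
  obtain v where "u * v = 1" using assms by (metis dvdE)
  then have "to_fr (Const u) * to_fr (Const v) = 1" by (simp flip: to_fr.hom_mult Const.hom_mult)
  then show ?thesis
    using units_multD[OF const_mem const_mem, of u v] units_one by simp
qed

end

definition poly_ring ::
  "nat set \<Rightarrow> (nat \<Rightarrow> 'a::{factorial_semiring,idom,ring_char_0} ratfun) \<Rightarrow> 'a ratfun set" where
  "poly_ring A x = {evalF x p | p. vars p \<subseteq> A}"

lemma poly_ringI: "vars p \<subseteq> A \<Longrightarrow> evalF x p \<in> poly_ring A x"
  by (auto simp: poly_ring_def)

interpretation poly_ring: subalgebra "poly_ring A x" for A x
proof
  show "to_fr (Const c) \<in> poly_ring A x" for c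
    using poly_ringI[of "Const c" A x] by simp
  fix f g assume "f \<in> poly_ring A x" "g \<in> poly_ring A x"
  then obtain p q where pq: "f = evalF x p" "vars p \<subseteq> A" "g = evalF x q" "vars q \<subseteq> A"
    by (auto simp: poly_ring_def)
  then have "vars (p + q) \<subseteq> A" "vars (p * q) \<subseteq> A"
    using vars_add[of p q] vars_mult[of p q] by auto
  from this[THEN poly_ringI, of x] show "f + g \<in> poly_ring A x" "f * g \<in> poly_ring A x"
    by (simp_all add: pq)
qed

lemma poly_ring_var: "l \<in> A \<Longrightarrow> x l \<in> poly_ring A x"
  using poly_ringI[of "Var l" A x] by simp

lemma (in subalgebra) poly_ring_subset:
  assumes "\<And>l. l \<in> A \<Longrightarrow> x l \<in> S"
  shows "poly_ring A x \<subseteq> S"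
  using assms by (auto simp: poly_ring_def intro!: evalF_mem)

lemma poly_ring_unit:
  assumes x: "alg_indep n x" and f: "f \<in> units (poly_ring {..<n} x)"
  obtains u where "u dvd 1" "f = to_fr (Const u)"
proof -
  obtain p q where p: "f = evalF x p" "in_vars n p" and q: "inverse f = evalF x q" "in_vars n q"
    using f by (auto simp: units_def poly_ring_def in_vars_def)
  have "evalF x (p * q) = evalF x 1" using f by (simp add: units_def flip: p(1) q(1))
  then have "p * q = 1"
    using p(2) q(2) alg_indep_evalF_eq_iff[OF x, of "p * q" 1]
    by (simp only: in_vars_mult in_vars_one)
  then have "p dvd 1" by (metis dvd_triv_left)
  then show ?thesis using that p(1) by (auto elim: is_unit_mpolyE)
qed

section \<open>Discrete valuation rings centred on a polynomial ring\<close>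

definition uniformizer :: "'b::field set \<Rightarrow> 'b \<Rightarrow> bool" where
  "uniformizer V \<pi> \<longleftrightarrow> \<pi> \<in> V - units V \<and> \<pi> \<noteq> 0 \<and> (\<forall>f\<in>V - units V. f / \<pi> \<in> V)"

definition localization ::
  "'a::{factorial_semiring,idom,ring_char_0} ratfun set \<Rightarrow> nat \<Rightarrow> (nat \<Rightarrow> 'a ratfun) \<Rightarrow>
    'a ratfun set" where
  "localization V n z = {f / g | f g. f \<in> poly_ring {..<n} z \<and> g \<in> poly_ring {..<n} z \<inter> units V}"

definition unit_coordinates ::
  "'a::{factorial_semiring,idom,ring_char_0} ratfun set \<Rightarrow> nat \<Rightarrow> (nat \<Rightarrow> 'a ratfun) \<Rightarrow> bool" where
  "unit_coordinates V n z \<longleftrightarrow> (\<forall>l<n. z l \<in> units V) \<and> V \<subseteq> localization V n z"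

lemma unit_coordinatesD: "unit_coordinates V n z \<Longrightarrow> l < n \<Longrightarrow> z l \<in> units V"
  by (simp add: unit_coordinates_def)

lemma (in subalgebra) subalgebra_localization: "subalgebra (localization S n z)"
proof -
  let ?L = "localization S n z" and ?P = "poly_ring {..<n} z"
  show ?thesis
  proof
    have "to_fr (Const c) / 1 \<in> ?L" for c
      unfolding localization_def using poly_ring.const_mem poly_ring.one_mem units_one by blast
    then show "to_fr (Const c) \<in> ?L" for c by simp
    fix f g assume "f \<in> ?L" "g \<in> ?L"
    then obtain a b c d where fractions: "f = a / b" "g = c / d" "a \<in> ?P" "c \<in> ?P"
      "b \<in> ?P \<inter> units S" "d \<in> ?P \<inter> units S"
      by (auto simp: localization_def)
    then have "f + g = (a * d + c * b) / (b * d)" "f * g = (a * c) / (b * d)"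
      by (simp_all add: units_def add_frac_eq)
    moreover have "b * d \<in> ?P \<inter> units S" "a * d + c * b \<in> ?P" "a * c \<in> ?P"
      using fractions by (simp_all add: units_mult poly_ring.mult_mem poly_ring.add_mem)
    ultimately show "f + g \<in> ?L" "f * g \<in> ?L" by (auto simp: localization_def)
  qed
qed

locale discrete_valuation_ring = subalgebra V for V +
  assumes uniformizer_exists: "\<exists>\<pi>. uniformizer V \<pi>"
begin

sublocale localization: subalgebra "localization V n z" for n z
  by (rule subalgebra_localization)

lemma poly_ring_subset_localization: "poly_ring {..<n} z \<subseteq> localization V n z"
proof
  fix f assume "f \<in> poly_ring {..<n} z"
  then have "f / 1 \<in> localization V n z"
    unfolding localization_def using poly_ring.one_mem units_one by blast
  then show "f \<in> localization V n z" by simp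
qed

lemma localization_var: "l < n \<Longrightarrow> z l \<in> localization V n z"
  using poly_ring_subset_localization poly_ring_var[of l "{..<n}" z] by auto

lemma localization_divide:
  assumes "f \<in> localization V n z" "g \<in> localization V n z" "g \<in> units V"
  shows "f / g \<in> localization V n z"
proof -
  let ?P = "poly_ring {..<n} z"
  obtain c d where g: "g = c / d" "c \<in> ?P" "d \<in> ?P" "d \<in> units V"
    using assms(2) by (auto simp: localization_def)
  then have "c = g * d" by (simp add: units_def)
  then have "c \<in> units V" using units_mult assms(3) g(4) by simp
  then have "d / c \<in> localization V n z" using g by (auto simp: localization_def)
  then show ?thesis using localization.mult_mem[OF assms(1), of "d / c"] by (simp add: g(1))
qed

lemma unit_coordinates_transfer:
  assumes "unit_coordinates V n z" "\<And>l. l < n \<Longrightarrow> z' l \<in> units V"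
    and "\<And>l. l < n \<Longrightarrow> z l \<in> localization V n z'"
  shows "unit_coordinates V n z'"
proof -
  have "poly_ring {..<n} z \<subseteq> localization V n z'"
    using assms(3) by (intro localization.poly_ring_subset) simp
  then have "localization V n z \<subseteq> localization V n z'"
    by (auto simp: localization_def[of V n z] intro!: localization_divide)
  then show ?thesis using assms(1,2) by (auto simp: unit_coordinates_def)
qed

lemma unit_coordinates_invert:
  assumes z: "unit_coordinates V n z" and k: "k < n"
    and c: "vars c \<subseteq> {..<n} - {k}" "evalF z c \<in> units V"
    and d: "vars d \<subseteq> {..<n} - {k}" "evalF z d \<in> units V"
    and z'k: "z' k = evalF z c / (evalF z d * z k)" and z': "\<And>l. l < n \<Longrightarrow> l \<noteq> k \<Longrightarrow> z' l = z l"
  shows "unit_coordinates V n z'"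
proof (rule unit_coordinates_transfer[OF z])
  note zU = unit_coordinatesD[OF z]
  show units: "z' l \<in> units V" if "l < n" for l
    using that zU c(2) d(2) z' by (cases "l = k") (auto simp: z'k units_divide units_mult)
  have eq: "evalF z' p = evalF z p" if "vars p \<subseteq> {..<n} - {k}" for p
    using that z' by (intro evalF_cong) auto
  have mem: "evalF z p \<in> localization V n z'" if "vars p \<subseteq> {..<n} - {k}" for p
    unfolding eq[OF that, symmetric] using that poly_ringI[of p "{..<n}" z']
      poly_ring_subset_localization[of n z'] by auto
  have "z k = evalF z c / (evalF z d * z' k)"
    using c(2) d(2) zU[OF k] by (simp add: z'k units_def)
  moreover have "evalF z c / (evalF z d * z' k) \<in> localization V n z'"
    by (intro localization_divide localization.mult_mem mem c d localization_var units_mult units k)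
  ultimately have "z k \<in> localization V n z'" by simp
  then show "z l \<in> localization V n z'" if "l < n" for l
    using that localization_var[of l n z'] z' by (cases "l = k") auto
qed

lemma evalF_mem_unit_coordinates:
  assumes "unit_coordinates V n z" "in_vars n p"
  shows "evalF z p \<in> V"
  using assms by (intro evalF_mem) (auto simp: in_vars_def unit_coordinatesD units_subset)

lemma irreducible_factor_nonunit:
  assumes z: "unit_coordinates V n z" and p: "p \<noteq> 0" "in_vars n p" "evalF z p \<notin> units V"
  shows "\<exists>q. irreducible q \<and> q dvd p \<and> evalF z q \<notin> units V"
  using p
proof (induction p rule: mpoly_factor_induct)
  case (unit u)
  then show ?case by (auto elim!: is_unit_mpolyE simp: units_const)
next
  case (mult a b)
  then have "in_vars n a" "in_vars n b" "evalF z a \<notin> units V \<or> evalF z b \<notin> units V"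
    using in_vars_multD[of n a b] units_mult by auto
  then show ?case using mult.IH by (metis dvd_mult dvd_mult2)
qed auto

lemma uniformizer_dvd:
  assumes z: "unit_coordinates V n z" "alg_indep n z"
    and q: "irreducible q" "in_vars n q" "uniformizer V (evalF z q)"
    and p: "in_vars n p" "evalF z p \<notin> units V"
  shows "q dvd p"
proof -
  have q_nonunit: "evalF z q \<noteq> 0" "evalF z q \<notin> units V" using q(3) by (auto simp: uniformizer_def)
  have "evalF z p / evalF z q \<in> V"
    using q(3) p evalF_mem_unit_coordinates[OF z(1)] by (simp add: uniformizer_def)
  then obtain a b where fraction: "evalF z p / evalF z q = evalF z a / evalF z b"
    "in_vars n a" "in_vars n b" "evalF z b \<in> units V"
    using z(1) by (auto simp: unit_coordinates_def localization_def poly_ring_def in_vars_def)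
  have "evalF z (p * b) = evalF z (q * a)"
    using fraction(1) q_nonunit(1) units_nonzero[OF fraction(4)]
    by (simp add: frac_eq_eq mult.commute)
  then have "p * b = q * a"
    using alg_indep_evalF_eq_iff[OF z(2)] p q fraction
    by (simp add: in_vars_mult del: evalF.hom_mult)
  then have "q dvd p \<or> q dvd b"
    using irreducible_imp_prime_elem_mpoly[OF q(1)] by (metis dvd_triv_left prime_elem_dvd_mult_iff)
  moreover have "\<not> q dvd b"
  proof
    assume "q dvd b"
    then obtain c where c: "b = q * c" by (elim dvdE)
    have "b \<noteq> 0" using units_nonzero[OF fraction(4)] by auto
    then have "in_vars n c" using in_vars_dvd[of c b n] fraction(3) c by simp
    then have "evalF z q \<in> units V"
      using units_multD[of "evalF z q" "evalF z c"] fraction(4) c q(2)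
        evalF_mem_unit_coordinates[OF z(1)]
      by simp
    then show False using q_nonunit(2) by simp
  qed
  ultimately show ?thesis by blast
qed

lemma irreducible_uniformizer_exists:
  assumes z: "unit_coordinates V n z"
  shows "\<exists>q. irreducible q \<and> in_vars n q \<and> uniformizer V (evalF z q)"
proof -
  obtain \<pi> where \<pi>: "uniformizer V \<pi>" using uniformizer_exists by blast
  then obtain a b where fraction: "\<pi> = evalF z a / evalF z b"
    "in_vars n a" "in_vars n b" "evalF z b \<in> units V"
    using z
    by (auto simp: unit_coordinates_def uniformizer_def localization_def poly_ring_def in_vars_def)
  have "a \<noteq> 0" "evalF z a \<notin> units V"
    using \<pi> fraction(1,4) units_divide by (auto simp: uniformizer_def)
  then obtain q where q: "irreducible q" "q dvd a" "evalF z q \<notin> units V"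
    using irreducible_factor_nonunit[OF z] fraction(2) by blast
  then obtain c where c: "a = q * c" by (elim dvdE)
  have in_vars: "in_vars n q" "in_vars n c"
    using in_vars_dvd[of _ a n] \<open>a \<noteq> 0\<close> fraction(2) c by simp_all
  note mem = evalF_mem_unit_coordinates[OF z in_vars(1)] evalF_mem_unit_coordinates[OF z in_vars(2)]
  have \<pi>_eq: "\<pi> = evalF z q * (evalF z c / evalF z b)" by (simp add: fraction(1) c)
  then have q_nonzero: "evalF z q \<noteq> 0" using \<pi> by (auto simp: uniformizer_def)
  have "f / evalF z q \<in> V" if "f \<in> V - units V" for f
  proof -
    have "f / \<pi> \<in> V" using \<pi> that by (simp add: uniformizer_def)
    then have "(f / \<pi>) * (evalF z c / evalF z b) \<in> V"
      using divide_units_mem[OF mem(2) fraction(4)] by (rule mult_mem)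
    moreover have "(f / \<pi>) * (evalF z c / evalF z b) = f / evalF z q"
      using \<pi> q_nonzero by (auto simp: \<pi>_eq uniformizer_def field_simps)
    ultimately show ?thesis by simp
  qed
  then have "uniformizer V (evalF z q)" using q(3) q_nonzero mem(1) by (simp add: uniformizer_def)
  then show ?thesis using q(1) in_vars(1) by blast
qed

lemma irreducible_nonunit_dvd:
  assumes z: "unit_coordinates V n z" "alg_indep n z"
    and q: "irreducible q" "in_vars n q" "evalF z q \<notin> units V"
    and p: "in_vars n p" "evalF z p \<notin> units V"
  shows "q dvd p"
proof -
  obtain r where r: "irreducible r" "in_vars n r" "uniformizer V (evalF z r)"
    using irreducible_uniformizer_exists[OF z(1)] by blast
  then have "r dvd q" "r dvd p" using uniformizer_dvd[OF z] p q(2,3) by blast+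
  then show ?thesis using irreducible_dvd_irreducible[OF q(1) r(1)] dvd_trans by blast
qed

end

definition adic_ring ::
  "nat \<Rightarrow> (nat \<Rightarrow> 'a::{factorial_semiring,idom,ring_char_0} ratfun) \<Rightarrow> 'a mpoly \<Rightarrow> 'a ratfun set" where
  "adic_ring n z q = {evalF z a / evalF z b | a b. in_vars n a \<and> in_vars n b \<and> \<not> q dvd b}"

lemma adic_ringI: "in_vars n a \<Longrightarrow> in_vars n b \<Longrightarrow> \<not> q dvd b \<Longrightarrow> evalF z a / evalF z b \<in> adic_ring n z q"
  by (auto simp: adic_ring_def)

context
  fixes n :: nat
    and z :: "nat \<Rightarrow> 'a::{factorial_semiring,idom,ring_char_0} ratfun"
    and q :: "'a mpoly"
  assumes z: "alg_indep n z" and q: "irreducible q" "in_vars n q"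
begin

lemma evalF_nonzero_if_not_dvd: "in_vars n b \<Longrightarrow> \<not> q dvd b \<Longrightarrow> evalF z b \<noteq> 0"
  using alg_indep_evalF_eq_0_iff[OF z] by auto

lemma subalgebra_adic_ring: "subalgebra (adic_ring n z q)"
proof
  have "\<not> q dvd 1" using q(1) by (simp add: irreducible_def)
  then show "to_fr (Const c) \<in> adic_ring n z q" for c
    using adic_ringI[of n "Const c" 1 q z] by simp
  fix f g assume "f \<in> adic_ring n z q" "g \<in> adic_ring n z q"
  then obtain a b c d where fractions: "f = evalF z a / evalF z b" "g = evalF z c / evalF z d"
    "in_vars n a" "in_vars n b" "in_vars n c" "in_vars n d" "\<not> q dvd b" "\<not> q dvd d"
    by (auto simp: adic_ring_def)
  have "f + g = evalF z (a * d + c * b) / evalF z (b * d)"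
    and "f * g = evalF z (a * c) / evalF z (b * d)"
    using fractions evalF_nonzero_if_not_dvd by (simp_all add: add_frac_eq)
  moreover have "\<not> q dvd b * d"
    using fractions irreducible_imp_prime_elem_mpoly[OF q(1)] by (simp add: prime_elem_dvd_mult_iff)
  ultimately show "f + g \<in> adic_ring n z q" "f * g \<in> adic_ring n z q"
    using fractions
    by (auto simp del: evalF.hom_mult evalF.hom_add intro!: adic_ringI in_vars_mult in_vars_add)
qed

lemma evalF_units_adic_ring_iff:
  assumes "in_vars n a"
  shows "evalF z a \<in> units (adic_ring n z q) \<longleftrightarrow> \<not> q dvd a"
proof
  have "\<not> q dvd 1" using q(1) by (simp add: irreducible_def)
  then show "evalF z a \<in> units (adic_ring n z q)" if "\<not> q dvd a"
    using adic_ringI[of n a 1 q z] adic_ringI[of n 1 a q z] assms that evalF_nonzero_if_not_dvd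
    by (simp add: units_def inverse_eq_divide)
  assume "evalF z a \<in> units (adic_ring n z q)"
  then obtain c d where fraction: "inverse (evalF z a) = evalF z c / evalF z d" "evalF z a \<noteq> 0"
    "in_vars n c" "in_vars n d" "\<not> q dvd d"
    by (auto simp: units_def adic_ring_def)
  then have "evalF z (a * c) = evalF z d"
    using evalF_nonzero_if_not_dvd[of d] by (simp add: field_simps)
  then have "a * c = d"
    using alg_indep_evalF_eq_iff[OF z] assms fraction
    by (simp add: in_vars_mult del: evalF.hom_mult)
  then show "\<not> q dvd a" using fraction(5) by auto
qed

lemma uniformizer_adic_ring: "uniformizer (adic_ring n z q) (evalF z q)"
proof -
  interpret subalgebra "adic_ring n z q" by (rule subalgebra_adic_ring)
  have not_dvd_1: "\<not> q dvd 1" and q_nonzero: "evalF z q \<noteq> 0"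
    using q alg_indep_evalF_eq_0_iff[OF z] by (auto simp: irreducible_def)
  have "f / evalF z q \<in> adic_ring n z q"
    if f: "f \<in> adic_ring n z q" "f \<notin> units (adic_ring n z q)" for f
  proof -
    obtain a b where fraction: "f = evalF z a / evalF z b" "in_vars n a" "in_vars n b" "\<not> q dvd b"
      using f(1) by (auto simp: adic_ring_def)
    then have "q dvd a" using f(2) units_divide evalF_units_adic_ring_iff by auto
    then obtain c where c: "a = q * c" by (elim dvdE)
    have "in_vars n c"
      using in_vars_dvd[of c a n] fraction(2) c q(1) by (cases "a = 0") auto
    then show ?thesis
      using adic_ringI[of n c b q z] fraction(3,4) q_nonzero by (simp add: fraction(1) c)
  qed
  then show ?thesis
    using adic_ringI[of n q 1 q z] evalF_units_adic_ring_iff[OF q(2)] q(2) q_nonzero not_dvd_1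
    by (simp add: uniformizer_def)
qed

lemma discrete_valuation_ring_adic_ring: "discrete_valuation_ring (adic_ring n z q)"
  using subalgebra_adic_ring uniformizer_adic_ring
  by (auto simp: discrete_valuation_ring_def discrete_valuation_ring_axioms_def)

lemma unit_coordinates_adic_ring:
  assumes "\<And>l. l < n \<Longrightarrow> \<not> q dvd Var l"
  shows "unit_coordinates (adic_ring n z q) n z"
proof -
  have "z l \<in> units (adic_ring n z q)" if "l < n" for l
    using evalF_units_adic_ring_iff[of "Var l"] assms that by (simp add: in_vars_Var)
  moreover have "adic_ring n z q \<subseteq> localization (adic_ring n z q) n z"
  proof
    fix f assume "f \<in> adic_ring n z q"
    then obtain a b where f: "f = evalF z a / evalF z b"
      and "in_vars n a" "in_vars n b" "\<not> q dvd b"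
      by (auto simp: adic_ring_def)
    then have "evalF z a \<in> poly_ring {..<n} z"
      and "evalF z b \<in> poly_ring {..<n} z \<inter> units (adic_ring n z q)"
      by (simp_all add: evalF_units_adic_ring_iff poly_ringI flip: in_vars_def)
    then show "f \<in> localization (adic_ring n z q) n z"
      unfolding f localization_def by blast
  qed
  ultimately show ?thesis by (simp add: unit_coordinates_def)
qed

end

section \<open>Mutation of seeds adapted to a discrete valuation ring\<close>

lemma
  assumes "is_LP_seed n (x, F)"
  shows LP_seed_alg_indep: "alg_indep n x"
    and LP_seed_in_vars: "k < n \<Longrightarrow> in_vars n (F k)"
    and LP_seed_vars: "k < n \<Longrightarrow> vars (F k) \<subseteq> {..<n} - {k}"
    and LP_seed_irreducible: "k < n \<Longrightarrow> irreducible (F k)"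
    and LP_seed_Var_not_dvd: "k < n \<Longrightarrow> l < n \<Longrightarrow> \<not> Var l dvd F k"
  using assms by (auto simp: is_LP_seed_def trans_basis_def in_vars_def Let_def)

lemma LP_seed_nonzero: "is_LP_seed n (x, F) \<Longrightarrow> k < n \<Longrightarrow> F k \<noteq> 0"
  using LP_seed_irreducible[of n x F k] by (metis not_irreducible_zero)

lemma LP_seed_evalF_nonzero:
  assumes "is_LP_seed n (x, F)" "k < n"
  shows "evalF x (F k) \<noteq> 0"
  using alg_indep_evalF_eq_0_iff[OF LP_seed_alg_indep[OF assms(1)] LP_seed_in_vars[OF assms]]
    LP_seed_nonzero[OF assms] by simp

lemma LP_seed_alg_indep_blowup:
  assumes seed: "is_LP_seed n (x, F)" and k: "k < n"
  shows "alg_indep n (blowup k (F k) x)"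
  using LP_seed_vars[OF seed k]
  by (intro alg_indep_blowup LP_seed_alg_indep[OF seed] LP_seed_nonzero[OF seed]
      LP_seed_in_vars[OF seed] k) auto

lemma LP_seed_evalF_blowup:
  assumes "is_LP_seed n (x, F)" "k < n"
  shows "evalF (blowup k (F k) x) (F k) = evalF x (F k)"
  using LP_seed_vars[OF assms] by (intro evalF_blowup) auto

lemma
  assumes "LP_mutation n k (x, F) (x', F')"
  shows LP_mutation_var: "x' k = evalF x (F k) / (evalF x (exch_den n F k {}) * x k)"
    and LP_mutation_other_var: "l < n \<Longrightarrow> l \<noteq> k \<Longrightarrow> x' l = x l"
    and LP_mutation_poly: "\<exists>u. u dvd 1 \<and> F' k = Const u * F k"
    and LP_mutation_notin_vars:
      "l < n \<Longrightarrow> l \<noteq> k \<Longrightarrow> k \<notin> vars (F l) \<Longrightarrow> \<exists>u. u dvd 1 \<and> F' l = Const u * F l"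
    and LP_mutation_in_vars: "l < n \<Longrightarrow> l \<noteq> k \<Longrightarrow> k \<in> vars (F l) \<Longrightarrow> new_exch_poly n F k l (F' l)"
  using assms by (auto simp: LP_mutation_def hatF_def Let_def)

lemma vars_exch_den:
  fixes F :: "nat \<Rightarrow> 'a::{factorial_semiring,idom,ring_char_0} mpoly"
  shows "vars (exch_den n F j E) \<subseteq> {..<n} - ({j} \<union> E)"
  unfolding exch_den_def
proof (rule vars_prod)
  fix l assume "l \<in> {..<n} - ({j} \<union> E)"
  then show "vars (Var l ^ exch_exp F j l :: 'a mpoly) \<subseteq> {..<n} - ({j} \<union> E)"
    using vars_power[of "Var l :: 'a mpoly" "exch_exp F j l"] by auto
qed

lemma exch_den_remove:
  assumes "k < n" "k \<noteq> j"
  shows "exch_den n F j {} = Var k ^ exch_exp F j k * exch_den n F j {k}"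
proof -
  have indices: "{..<n} - ({j} \<union> {}) = insert k ({..<n} - ({j} \<union> {k}))" using assms by auto
  show ?thesis unfolding exch_den_def indices by (subst prod.insert) simp_all
qed

lemma exch_exp_altdef: "exch_exp F j k = (GREATEST e. F k ^ e dvd scale_var k (F k) (F j))"
  by (simp add: exch_exp_def scale_var_def)

lemma exch_exp_decomposition:
  assumes "irreducible (F k)" "scale_var k (F k) (F j) \<noteq> 0"
  obtains h where "scale_var k (F k) (F j) = F k ^ exch_exp F j k * h" "\<not> F k dvd h"
proof -
  obtain a h where h: "scale_var k (F k) (F j) = F k ^ a * h" "\<not> F k dvd h"
    using prime_power_decomposition[OF assms(2,1)] by blast
  have "F k \<noteq> 0" using assms(1) by (metis not_irreducible_zero)
  then have "exch_exp F j k = a"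
    unfolding exch_exp_altdef h(1) by (rule Greatest_power_dvd[OF _ h(2)])
  then show ?thesis using that h by blast
qed

context subalgebra
begin

lemma units_exch_den:
  assumes "\<And>l. l < n \<Longrightarrow> l \<noteq> j \<Longrightarrow> l \<notin> E \<Longrightarrow> x l \<in> units S"
  shows "evalF x (exch_den n F j E) \<in> units S"
  using assms by (auto simp: exch_den_def evalF.hom_prod intro!: units_prod units_power)

lemma units_monom1:
  assumes "\<And>l. l \<in> Poly_Mapping.keys \<alpha> \<Longrightarrow> x l \<in> units S"
  shows "evalF x (monom1 \<alpha>) \<in> units S"
  using assms by (auto simp: evalF_monom1 monom_value_def intro!: units_prod units_power)

end

lemma new_exch_polyE:
  assumes new: "new_exch_poly n F j k F'\<^sub>k" and y: "evalF y (exch_den n F j {k} * Var j) \<noteq> 0"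
  obtains u \<alpha> \<beta> D where "u dvd 1"
    and "Poly_Mapping.keys \<alpha> \<subseteq> {..<n} - {k}" "Poly_Mapping.keys \<beta> \<subseteq> {..<n} - {k}"
    and "D \<noteq> 0" "in_vars n D" "\<And>q. irreducible q \<Longrightarrow> q dvd D \<Longrightarrow> q dvd set_zero k (F j)"
    and "evalF y F'\<^sub>k * (evalF y (monom1 \<beta>) * evalF y D) = to_fr (Const u) * evalF y (monom1 \<alpha>) *
      evalF (y(j := evalF y (set_zero k (F j)) / evalF y (exch_den n F j {k} * Var j))) (F k)"
proof -
  let ?X = "\<lambda>l. to_fr (Var l)"
  define P B N where "P = set_zero k (F j)" and "B = exch_den n F j {k} * Var j"
    and "N = degree_in j (F k)"
  define G where "G = evalF (?X(j := to_fr P / to_fr B)) (F k)"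
  have "(\<lambda>l. if l = j then to_fr P / to_fr (exch_den n F j {k}) / to_fr (Var j)
      else to_fr (Var l)) = ?X(j := to_fr P / to_fr B)"
    by (auto simp: B_def)
  then have "eval_mp (\<lambda>c. to_fr (Const c)) (\<lambda>l. if l = j
      then to_fr P / to_fr (exch_den n F j {k}) / to_fr (Var j) else to_fr (Var l)) (F k) = G"
    by (simp add: G_def evalF_def)
  note new = new[unfolded new_exch_poly_def Let_def, folded set_zero_def, folded P_def,
      unfolded this]
  obtain D u \<alpha> \<beta> where D: "D \<noteq> 0" "in_vars n D"
    and D_dvd: "\<forall>q. irreducible q \<longrightarrow> q dvd D \<longrightarrow> proper_factor n q \<and> q dvd P"
    and u: "u dvd 1" and \<alpha>: "Poly_Mapping.keys \<alpha> \<subseteq> {..<n} - {k}"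
    and \<beta>: "Poly_Mapping.keys \<beta> \<subseteq> {..<n} - {k}"
    and F'\<^sub>k: "to_fr F'\<^sub>k = to_fr (Const u) * to_fr (monom1 \<alpha>) / to_fr (monom1 \<beta>) * (G / to_fr D)"
    using new by (elim exE conjE) (rule that)
  have B_nonzero: "B \<noteq> 0" using y by (auto simp: B_def)
  have "monom1 \<beta> \<noteq> (0 :: 'a mpoly)" by simp
  moreover have "to_fr (homogenize j (F k) P B) = to_fr B ^ N * G"
    using evalF_homogenize[of ?X B j "F k" P] B_nonzero by (simp add: N_def G_def evalF_to_fr_Var)
  ultimately have "to_fr (F'\<^sub>k * monom1 \<beta> * D * B ^ N) =
      to_fr (Const u * monom1 \<alpha> * homogenize j (F k) P B)"
    using D(1) by (simp add: F'\<^sub>k)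
  then have "F'\<^sub>k * monom1 \<beta> * D * B ^ N = Const u * monom1 \<alpha> * homogenize j (F k) P B"
    by (simp only: to_fr_eq_iff)
  from arg_cong[OF this, of "evalF y"]
  have "evalF y F'\<^sub>k * (evalF y (monom1 \<beta>) * evalF y D) =
      to_fr (Const u) * evalF y (monom1 \<alpha>) * evalF (y(j := evalF y P / evalF y B)) (F k)"
    using y by (simp add: evalF_homogenize N_def flip: B_def)
  then show ?thesis using that[OF u \<alpha> \<beta> D] D_dvd by (simp add: P_def B_def)
qed

definition exceptional ::
  "'a::{factorial_semiring,idom,ring_char_0} ratfun set \<Rightarrow> nat \<Rightarrow>
    (nat \<Rightarrow> 'a ratfun) \<Rightarrow> (nat \<Rightarrow> 'a mpoly) \<Rightarrow> nat \<Rightarrow> bool" where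
  "exceptional V n x F k \<longleftrightarrow> unit_coordinates V n (blowup k (F k) x) \<and> evalF x (F k) \<notin> units V"

definition adapted ::
  "'a::{factorial_semiring,idom,ring_char_0} ratfun set \<Rightarrow> nat \<Rightarrow>
    (nat \<Rightarrow> 'a ratfun) \<Rightarrow> (nat \<Rightarrow> 'a mpoly) \<Rightarrow> bool" where
  "adapted V n x F \<longleftrightarrow> unit_coordinates V n x \<or> (\<exists>k<n. exceptional V n x F k)"

lemma
  assumes "exceptional V n x F k"
  shows exceptional_unit_coordinates: "unit_coordinates V n (blowup k (F k) x)"
    and exceptional_nonunit: "evalF x (F k) \<notin> units V"
    and exceptional_units: "l < n \<Longrightarrow> l \<noteq> k \<Longrightarrow> x l \<in> units V"
    and exceptional_quotient_unit: "k < n \<Longrightarrow> x k / evalF x (F k) \<in> units V"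
  using assms unit_coordinatesD[of V n "blowup k (F k) x" l]
    unit_coordinatesD[of V n "blowup k (F k) x" k]
  by (auto simp: exceptional_def blowup_def)

lemma LP_seed_exceptional_exists:
  assumes seed: "is_LP_seed n (x, F)" and k: "k < n"
  obtains V where "discrete_valuation_ring V" "exceptional V n x F k"
proof (rule that)
  let ?z = "blowup k (F k) x"
  note F = LP_seed_irreducible[OF seed k] LP_seed_in_vars[OF seed k]
  note z = LP_seed_alg_indep_blowup[OF seed k]
  show "discrete_valuation_ring (adic_ring n ?z (F k))"
    by (rule discrete_valuation_ring_adic_ring[OF z F])
  have "\<not> F k dvd Var l" if "l < n" for l
    using irreducible_not_dvd_Var[OF F(1)] LP_seed_Var_not_dvd[OF seed k that] .
  then have "unit_coordinates (adic_ring n ?z (F k)) n ?z"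
    by (rule unit_coordinates_adic_ring[OF z F])
  then show "exceptional (adic_ring n ?z (F k)) n x F k"
    using evalF_units_adic_ring_iff[OF z F F(2)]
    by (simp add: exceptional_def LP_seed_evalF_blowup[OF seed k])
qed

context discrete_valuation_ring
begin

lemma exceptional_var_nonunit:
  assumes "exceptional V n x F k" "k < n"
  shows "x k \<notin> units V"
proof
  let ?f = "evalF x (F k)"
  assume "x k \<in> units V"
  then have "x k / (x k / ?f) \<in> units V"
    using exceptional_quotient_unit[OF assms] units_divide by blast
  moreover have "x k / (x k / ?f) = ?f" using units_nonzero[OF \<open>x k \<in> units V\<close>] by simp
  ultimately show False using exceptional_nonunit[OF assms(1)] by simp
qed

lemma adapted_imp_exceptional:
  assumes "adapted V n x F" "i < n" "x i \<notin> units V"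
  shows "exceptional V n x F i"
proof -
  obtain k where "k < n" "exceptional V n x F k"
    using assms unit_coordinatesD[of V n x i] by (auto simp: adapted_def)
  moreover from this have "k = i" using exceptional_units assms(2,3) by metis
  ultimately show ?thesis by simp
qed

lemma exceptional_not_dvd_unit:
  assumes seed: "is_LP_seed n (x, F)" and k: "k < n" and exc: "exceptional V n x F k"
    and p: "in_vars n p" "\<not> F k dvd p"
  shows "evalF (blowup k (F k) x) p \<in> units V"
proof -
  have "evalF (blowup k (F k) x) (F k) \<notin> units V"
    using exceptional_nonunit[OF exc] by (simp add: LP_seed_evalF_blowup[OF seed k])
  then show ?thesis
    using irreducible_nonunit_dvd[OF exceptional_unit_coordinates[OF exc]
        LP_seed_alg_indep_blowup[OF seed k] LP_seed_irreducible[OF seed k]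
        LP_seed_in_vars[OF seed k] _ p(1)] p(2)
    by blast
qed

lemma exceptional_divide_mem_poly_ring:
  assumes seed: "is_LP_seed n (x, F)" and k: "k < n" and exc: "exceptional V n x F k"
    and f: "f \<in> poly_ring ({..<n} - {k}) x" "f \<notin> units V"
  shows "f / evalF x (F k) \<in> poly_ring ({..<n} - {k}) x"
proof -
  obtain p where p: "f = evalF x p" "vars p \<subseteq> {..<n} - {k}" using f(1) by (auto simp: poly_ring_def)
  then have "in_vars n p" "evalF (blowup k (F k) x) p = f"
    by (auto simp: in_vars_def intro: evalF_blowup)
  then have "F k dvd p" using exceptional_not_dvd_unit[OF seed k exc] f(2) by blast
  then obtain q where q: "p = F k * q" by (elim dvdE)
  have "vars q \<subseteq> {..<n} - {k}"
  proof (cases "q = 0")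
    case False
    then show ?thesis using p(2) q vars_mult_eq[OF LP_seed_nonzero[OF seed k]] by simp
  qed simp
  moreover have "f / evalF x (F k) = evalF x q"
    using LP_seed_evalF_nonzero[OF seed k] by (simp add: p(1) q)
  ultimately show ?thesis by (simp add: poly_ringI)
qed

lemma unit_coordinates_exch_den:
  assumes "unit_coordinates V n x"
  shows "evalF x (exch_den n F k E) \<in> units V"
  using unit_coordinatesD[OF assms] by (intro units_exch_den)

lemma unit_coordinates_mutation_unit:
  assumes seed: "is_LP_seed n (x, F)" and mutation: "LP_mutation n k (x, F) (x', F')"
    and k: "k < n" and x: "unit_coordinates V n x" and unit: "evalF x (F k) \<in> units V"
  shows "unit_coordinates V n x'"
proof (rule unit_coordinates_invert[OF x k LP_seed_vars[OF seed k] unit])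
  show "vars (exch_den n F k {}) \<subseteq> {..<n} - {k}" using vars_exch_den[of n F k "{}"] by simp
  show "evalF x (exch_den n F k {}) \<in> units V" by (rule unit_coordinates_exch_den[OF x])
  show "x' k = evalF x (F k) / (evalF x (exch_den n F k {}) * x k)"
    by (rule LP_mutation_var[OF mutation])
qed (rule LP_mutation_other_var[OF mutation])

lemma unit_coordinates_mutation_nonunit:
  assumes seed: "is_LP_seed n (x, F)" and mutation: "LP_mutation n k (x, F) (x', F')"
    and k: "k < n" and x: "unit_coordinates V n x" and nonunit: "evalF x (F k) \<notin> units V"
  shows "exceptional V n x' F' k"
  unfolding exceptional_def
proof
  let ?d = "exch_den n F k {}"
  obtain u where u: "u dvd 1" "F' k = Const u * F k" using LP_mutation_poly[OF mutation] by blast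
  note u_unit = units_const[OF u(1)] and x' = LP_mutation_other_var[OF mutation]
  have "evalF x' (F k) = evalF x (F k)"
    using LP_seed_vars[OF seed k] x' by (intro evalF_cong) auto
  then have F'k: "evalF x' (F' k) = to_fr (Const u) * evalF x (F k)" by (simp add: u(2))
  show "unit_coordinates V n (blowup k (F' k) x')"
  proof (rule unit_coordinates_invert[OF x k, where c = 1 and d = "Const u * ?d"])
    show "vars 1 \<subseteq> {..<n} - {k}" "evalF x 1 \<in> units V" by (simp_all add: units_one)
    show "vars (Const u * ?d) \<subseteq> {..<n} - {k}"
      using vars_exch_den[of n F k "{}"] vars_mult[of "Const u" ?d] by simp
    show "evalF x (Const u * ?d) \<in> units V"
      using u_unit unit_coordinates_exch_den[OF x] by (simp add: units_mult)
    show "blowup k (F' k) x' k = evalF x 1 / (evalF x (Const u * ?d) * x k)"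
      using LP_seed_evalF_nonzero[OF seed k]
      by (simp add: blowup_def F'k LP_mutation_var[OF mutation])
  qed (simp add: blowup_def x')
  show "evalF x' (F' k) \<notin> units V"
    using nonunit by (simp add: F'k units_mult_cancel[OF u_unit])
qed

lemma exceptional_mutation_same:
  assumes mutation: "LP_mutation n k (x, F) (x', F')"
    and k: "k < n" and exc: "exceptional V n x F k"
  shows "unit_coordinates V n x'"
proof (rule unit_coordinates_invert[OF exceptional_unit_coordinates[OF exc] k,
      where c = 1 and d = "exch_den n F k {}"])
  let ?d = "exch_den n F k {}" and ?z = "blowup k (F k) x"
  show "vars 1 \<subseteq> {..<n} - {k}" "evalF ?z 1 \<in> units V" by (simp_all add: units_one)
  show "vars ?d \<subseteq> {..<n} - {k}" using vars_exch_den[of n F k "{}"] by simp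
  show "evalF ?z ?d \<in> units V"
    by (rule unit_coordinates_exch_den[OF exceptional_unit_coordinates[OF exc]])
  have "evalF ?z ?d = evalF x ?d"
    using vars_exch_den[of n F k "{}"] by (intro evalF_blowup) auto
  then show "x' k = evalF ?z 1 / (evalF ?z ?d * ?z k)"
    by (simp add: LP_mutation_var[OF mutation]) (simp add: blowup_def)
qed (simp add: LP_mutation_other_var[OF mutation] blowup_def)

end

locale exceptional_mutation = discrete_valuation_ring V
  for V :: "'a::{factorial_semiring,idom,ring_char_0} ratfun set" +
  fixes n j k :: nat and x x' :: "nat \<Rightarrow> 'a ratfun" and F F' :: "nat \<Rightarrow> 'a mpoly"
  assumes seed: "is_LP_seed n (x, F)" and seed': "is_LP_seed n (x', F')"
    and mutation: "LP_mutation n j (x, F) (x', F')"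
    and j: "j < n" and k: "k < n" "k \<noteq> j"
    and exceptional: "exceptional V n x F k"
begin

abbreviation "f\<^sub>k \<equiv> evalF x (F k)"
abbreviation "f'\<^sub>k \<equiv> evalF x' (F' k)"
abbreviation "z \<equiv> blowup k (F k) x"
abbreviation "z' \<equiv> blowup k (F' k) x'"
abbreviation "d \<equiv> evalF x (exch_den n F j {k})"
abbreviation "L \<equiv> localization V n z'"
abbreviation "R' \<equiv> poly_ring ({..<n} - {k}) x'"

lemmas F\<^sub>j_vars = LP_seed_vars[OF seed j]
lemmas F\<^sub>k_vars = LP_seed_vars[OF seed k(1)]
lemmas F\<^sub>k_irreducible = LP_seed_irreducible[OF seed k(1)]
lemmas f\<^sub>k_nonzero = LP_seed_evalF_nonzero[OF seed k(1)]
lemmas x_units = exceptional_units[OF exceptional]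
lemmas not_dvd_unit = exceptional_not_dvd_unit[OF seed k(1) exceptional]

lemma x'_other: "l < n \<Longrightarrow> l \<noteq> j \<Longrightarrow> x' l = x l"
  by (rule LP_mutation_other_var[OF mutation])

lemma x_k_eq_z: "x k = z k * f\<^sub>k" and z_k_unit: "z k \<in> units V"
  using f\<^sub>k_nonzero exceptional_quotient_unit[OF exceptional k(1)] by (simp_all add: blowup_def)

lemma d_unit: "d \<in> units V"
  using x_units by (intro units_exch_den) auto

lemma evalF_z_scale_var: "evalF z (scale_var k (F k) p) = evalF x p"
  using F\<^sub>k_vars f\<^sub>k_nonzero by (intro evalF_blowup_scale_var) auto

lemma exchange_factor:
  obtains h where "scale_var k (F k) (F j) = F k ^ exch_exp F j k * h"
    and "evalF z h \<in> units V" "vars h \<subseteq> vars (F j) \<union> vars (F k)"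
    and "x' j = evalF z h / (z k ^ exch_exp F j k * d * x j)"
proof -
  let ?e = "exch_exp F j k"
  have "evalF z (scale_var k (F k) (F j)) \<noteq> 0"
    unfolding evalF_z_scale_var by (rule LP_seed_evalF_nonzero[OF seed j])
  then have nonzero: "scale_var k (F k) (F j) \<noteq> 0" by auto
  then obtain h where h: "scale_var k (F k) (F j) = F k ^ ?e * h" "\<not> F k dvd h"
    using exch_exp_decomposition F\<^sub>k_irreducible by blast
  have h_vars: "vars h \<subseteq> vars (F j) \<union> vars (F k)"
    using vars_dvd[OF _ nonzero, of h] vars_scale_var[of k "F k" "F j"] h(1) by auto
  have "in_vars n h" using h_vars F\<^sub>j_vars F\<^sub>k_vars by (auto simp: in_vars_def)
  then have "evalF z h \<in> units V" using not_dvd_unit h(2) by blast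
  moreover have "evalF x (F j) = f\<^sub>k ^ ?e * evalF z h"
    by (simp add: h(1) LP_seed_evalF_blowup[OF seed k(1)] flip: evalF_z_scale_var[of "F j"])
  then have "x' j = evalF z h / (z k ^ ?e * d * x j)"
    using f\<^sub>k_nonzero x_k_eq_z
    by (simp add: LP_mutation_var[OF mutation] exch_den_remove[OF k] power_mult_distrib)
  ultimately show ?thesis using that h(1) h_vars by blast
qed

lemma x'_units: "l < n \<Longrightarrow> l \<noteq> k \<Longrightarrow> x' l \<in> units V"
proof (cases "l = j")
  case True
  obtain h where h: "evalF z h \<in> units V" "x' j = evalF z h / (z k ^ exch_exp F j k * d * x j)"
    using exchange_factor by blast
  have "x j \<in> units V" using x_units j k(2) by simp
  then show ?thesis
    unfolding True h(2) by (intro units_divide units_mult units_power h(1) z_k_unit d_unit)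
qed (simp add: x'_other x_units)

lemma z'_other: "l \<noteq> k \<Longrightarrow> z' l = x' l"
  by (simp add: blowup_def)

lemma x'_mem_L: "l < n \<Longrightarrow> l \<noteq> k \<Longrightarrow> x' l \<in> L"
  using localization_var[of l n z'] by (simp add: z'_other)

lemma R'_subset_L: "R' \<subseteq> L"
  by (rule localization.poly_ring_subset) (simp add: x'_mem_L)

lemma d_mem_L: "d \<in> L"
proof (rule localization.evalF_mem)
  fix l assume "l \<in> vars (exch_den n F j {k})"
  then have "l < n" "l \<noteq> j" "l \<noteq> k" using vars_exch_den[of n F j "{k}"] by auto
  then show "x l \<in> L" using x'_mem_L x'_other by metis
qed

lemma exceptional_preservedI:
  assumes v: "v \<in> units V" "f'\<^sub>k = v * f\<^sub>k"
    and z_k: "z k \<in> L" and x_j: "x j \<in> L"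
  shows "exceptional V n x' F' k"
  unfolding exceptional_def
proof
  have "z' k = z k / v"
    using f\<^sub>k_nonzero k by (simp add: blowup_def x'_other v(2))
  then have "z' l \<in> units V" if "l < n" for l
    using that x'_units z_k_unit v(1) by (cases "l = k") (simp_all add: units_divide z'_other)
  moreover have "z l \<in> L" if "l < n" for l
  proof (cases "l = k \<or> l = j")
    case False
    then show ?thesis using x'_mem_L[OF that] x'_other[OF that] by (simp add: blowup_def)
  qed (use z_k x_j k in \<open>auto simp: blowup_def\<close>)
  ultimately show "unit_coordinates V n z'"
    by (rule unit_coordinates_transfer[OF exceptional_unit_coordinates[OF exceptional]])
  show "f'\<^sub>k \<notin> units V"
    using exceptional_nonunit[OF exceptional] by (simp add: v(2) units_mult_cancel[OF v(1)])
qed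

lemma exceptional_preserved_notin_vars:
  assumes notin: "j \<notin> vars (F k)"
  shows "exceptional V n x' F' k"
proof -
  obtain u where u: "u dvd 1" "F' k = Const u * F k"
    using LP_mutation_notin_vars[OF mutation k notin] by blast
  note u_unit = units_const[OF u(1)]
  have "evalF x' (F k) = f\<^sub>k"
    using F\<^sub>k_vars notin x'_other by (intro evalF_cong) auto
  then have f'\<^sub>k: "f'\<^sub>k = to_fr (Const u) * f\<^sub>k" by (simp add: u(2))
  then have "z k = to_fr (Const u) * z' k"
    using units_nonzero[OF u_unit] k by (simp add: blowup_def x'_other)
  then have z_k: "z k \<in> L"
    by (simp add: localization.mult_mem localization.const_mem localization_var k)
  obtain h where h: "evalF z h \<in> units V" "vars h \<subseteq> vars (F j) \<union> vars (F k)"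
    and x'_j_eq: "x' j = evalF z h / (z k ^ exch_exp F j k * d * x j)"
    using exchange_factor by blast
  have j_units: "x j \<in> units V" "x' j \<in> units V" using x_units x'_units j k(2) by simp_all
  have "evalF z h \<in> L"
  proof (rule localization.evalF_mem)
    fix l assume "l \<in> vars h"
    then have "l < n" "l \<noteq> j" using h(2) F\<^sub>j_vars F\<^sub>k_vars notin by auto
    then show "z l \<in> L"
      using z_k x'_mem_L[of l] x'_other[of l] by (cases "l = k") (simp_all add: blowup_def)
  qed
  then have "evalF z h / (z k ^ exch_exp F j k * d * x' j) \<in> L"
    using j k(2)
    by (intro localization_divide localization.mult_mem localization.power_mem z_k d_mem_L
        x'_mem_L units_mult units_power z_k_unit d_unit j_units) simp_all
  moreover have "x j = evalF z h / (z k ^ exch_exp F j k * d * x' j)"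
    using units_nonzero h(1) z_k_unit d_unit j_units by (simp add: x'_j_eq)
  ultimately show ?thesis using exceptional_preservedI[OF u_unit f'\<^sub>k z_k] by simp
qed

context
  assumes j_in_vars: "j \<in> vars (F k)"
begin

abbreviation "P \<equiv> set_zero k (F j)"
abbreviation "f\<^sub>j \<equiv> evalF x (F j)"
abbreviation "p \<equiv> evalF x P"
abbreviation "N \<equiv> degree_in j (F k)"
abbreviation "g \<equiv> evalF (x(j := p * x j / f\<^sub>j)) (F k)"

lemma P_vars: "vars P \<subseteq> {..<n} - {j, k}"
  using vars_set_zero[of k "F j"] F\<^sub>j_vars by auto

lemma in_vars_P: "in_vars n P"
  using P_vars by (auto simp: in_vars_def)

lemma not_dvd_P: "\<not> F k dvd P"
proof
  assume dvd: "F k dvd P"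
  have "Var k dvd F j - P" by (rule Var_dvd_diff_set_zero)
  then have "P \<noteq> 0" using LP_seed_Var_not_dvd[OF seed j k(1)] by auto
  then show False using vars_dvd[OF dvd] P_vars j_in_vars by auto
qed

lemma not_dvd_if_not_dvd_set_zero:
  assumes "\<not> F k dvd set_zero k q"
  shows "\<not> F k dvd q"
proof
  assume "F k dvd q"
  then have "set_zero k (F k) dvd set_zero k q" by (rule set_zero.hom_dvd)
  moreover have "set_zero k (F k) = F k" using F\<^sub>k_vars by (intro set_zero_idem) auto
  ultimately show False using assms by simp
qed

lemma p_unit: "p \<in> units V"
proof -
  have "evalF z P = p" using P_vars by (intro evalF_blowup) auto
  then show ?thesis using not_dvd_unit[OF in_vars_P not_dvd_P] by simp
qed

lemma f\<^sub>j_unit: "f\<^sub>j \<in> units V" and x'_j_eq: "x' j = f\<^sub>j / (d * x j)"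
proof -
  obtain h where h: "scale_var k (F k) (F j) = F k ^ exch_exp F j k * h" "evalF z h \<in> units V"
    and x'_j_eq: "x' j = evalF z h / (z k ^ exch_exp F j k * d * x j)"
    using exchange_factor by blast
  have "\<not> F k dvd scale_var k (F k) (F j)"
    using not_dvd_if_not_dvd_set_zero not_dvd_P by (simp add: set_zero_scale_var)
  then have "exch_exp F j k = 0" using h(1) by (cases "exch_exp F j k") auto
  moreover from this have "evalF z h = f\<^sub>j" using evalF_z_scale_var[of "F j"] h(1) by simp
  ultimately show "f\<^sub>j \<in> units V" "x' j = f\<^sub>j / (d * x j)" using h(2) x'_j_eq by simp_all
qed

text \<open>F j is congruent to P modulo X k. So the substitution for x j by which mutation turns f_k
  into g changes it only by a multiple of x k, after clearing denominators.\<close>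

lemma g_congruence:
  obtains t where "in_vars n t" "f\<^sub>j ^ N * g = p ^ N * f\<^sub>k + x k * evalF x t"
proof -
  let ?h = "homogenize j (F k) (P * Var j) (F j)"
  have "Var k dvd ?h - homogenize j (F k) (P * Var j) P"
    by (rule homogenize_diff_dvd[OF Var_dvd_diff_set_zero])
  then have "Var k dvd ?h - P ^ N * F k" by (simp add: homogenize_mult_Var)
  then obtain t where t: "?h - P ^ N * F k = Var k * t" by (elim dvdE)
  have "in_vars n (?h - P ^ N * F k)"
    using LP_seed_in_vars[OF seed] j k in_vars_P by (intro in_vars_intros in_vars_homogenize)
  then have "in_vars n t"
    using in_vars_dvd[of t "Var k * t" n] t by (cases "t = 0") auto
  moreover have "f\<^sub>j ^ N * g = evalF x ?h"
    using evalF_homogenize[of x "F j" j "F k" "P * Var j"] units_nonzero[OF f\<^sub>j_unit] by simp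
  moreover have "?h = P ^ N * F k + Var k * t" using t by (simp add: algebra_simps)
  then have "evalF x ?h = p ^ N * f\<^sub>k + x k * evalF x t" by simp
  ultimately show ?thesis using that by simp
qed

lemma g_div_f\<^sub>k_unit: "g / f\<^sub>k \<in> units V"
proof -
  obtain t where t: "in_vars n t" "f\<^sub>j ^ N * g = p ^ N * f\<^sub>k + x k * evalF x t"
    using g_congruence by blast
  define q where "q = P ^ N + Var k * scale_var k (F k) t"
  have "k \<notin> vars P" using P_vars by auto
  then have "set_zero k q = P ^ N" by (simp add: q_def set_zero_idem)
  moreover have "\<not> F k dvd P ^ N"
    using not_dvd_P prime_elem_dvd_power irreducible_imp_prime_elem_mpoly[OF F\<^sub>k_irreducible]
    by blast
  ultimately have "\<not> F k dvd q" using not_dvd_if_not_dvd_set_zero by simp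
  moreover have "in_vars n (scale_var k (F k) t)"
    using vars_scale_var[of k "F k" t] t(1) F\<^sub>k_vars by (auto simp: in_vars_def)
  then have "in_vars n q"
    unfolding q_def using in_vars_P k by (intro in_vars_intros)
  ultimately have "evalF z q \<in> units V" by (intro not_dvd_unit)
  moreover have "evalF z q = p ^ N + z k * evalF x t"
    using evalF_blowup[OF \<open>k \<notin> vars P\<close>] by (simp add: q_def evalF_z_scale_var)
  ultimately have "(p ^ N + z k * evalF x t) / f\<^sub>j ^ N \<in> units V"
    using units_divide[OF _ units_power[OF f\<^sub>j_unit]] by simp
  moreover have "f\<^sub>j ^ N * g = (p ^ N + z k * evalF x t) * f\<^sub>k"
    by (simp add: t(2) x_k_eq_z distrib_right)
  then have "g / f\<^sub>k = (p ^ N + z k * evalF x t) / f\<^sub>j ^ N"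
    using f\<^sub>k_nonzero units_nonzero[OF f\<^sub>j_unit] by (simp add: frac_eq_eq mult.commute)
  ultimately show ?thesis by simp
qed

lemma f'\<^sub>k_mult_eq:
  obtains a b where "a \<in> R' \<inter> units V"
    and "b \<in> R' \<inter> units V" "f'\<^sub>k * b = a * g"
proof -
  let ?B = "exch_den n F j {k} * Var j"
  have d: "evalF x' (exch_den n F j {k}) = d"
    using vars_exch_den[of n F j "{k}"] x'_other by (intro evalF_cong) auto
  have p: "evalF x' P = p" using P_vars x'_other by (intro evalF_cong) auto
  have B: "evalF x' ?B = f\<^sub>j / x j" "evalF x' ?B \<noteq> 0"
    using units_nonzero d_unit x_units[OF j] f\<^sub>j_unit k by (simp_all add: d x'_j_eq)
  obtain u \<alpha> \<beta> D where u: "u dvd 1"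
    and \<alpha>: "Poly_Mapping.keys \<alpha> \<subseteq> {..<n} - {k}" and \<beta>: "Poly_Mapping.keys \<beta> \<subseteq> {..<n} - {k}"
    and D: "D \<noteq> 0" "in_vars n D" "\<And>q. irreducible q \<Longrightarrow> q dvd D \<Longrightarrow> q dvd P"
    and eq: "f'\<^sub>k * (evalF x' (monom1 \<beta>) * evalF x' D) = to_fr (Const u) * evalF x' (monom1 \<alpha>) *
      evalF (x'(j := evalF x' P / evalF x' ?B)) (F k)"
    using new_exch_polyE[OF LP_mutation_in_vars[OF mutation k j_in_vars] B(2)] by blast
  have "evalF x' P / evalF x' ?B = p * x j / f\<^sub>j" unfolding p B(1) by simp
  then have g: "evalF (x'(j := evalF x' P / evalF x' ?B)) (F k) = g"
    using F\<^sub>k_vars x'_other by (intro evalF_cong) auto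
  have D_vars: "vars D \<subseteq> {..<n} - {j, k}"
    using vars_subset_if_irreducible_factors_dvd[OF D(1) _ D(3)] P_vars not_dvd_P
    by (cases "P = 0") auto
  have "evalF z D = evalF x' D"
    using D_vars x'_other by (intro evalF_cong) (auto simp: blowup_def)
  then have D_unit: "evalF x' D \<in> units V"
    using not_dvd_unit[OF D(2)] D(3)[OF F\<^sub>k_irreducible] not_dvd_P by auto
  have monom: "evalF x' (monom1 \<gamma>) \<in> R' \<inter> units V"
    if "Poly_Mapping.keys \<gamma> \<subseteq> {..<n} - {k}" for \<gamma>
    using that x'_units by (auto simp: vars_monom1 intro!: poly_ringI units_monom1)
  show ?thesis
  proof (rule that)
    show "to_fr (Const u) * evalF x' (monom1 \<alpha>) \<in> R' \<inter> units V"
      using monom[OF \<alpha>] units_const[OF u]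
      by (simp add: units_mult poly_ring.mult_mem poly_ring.const_mem)
    have "evalF x' D \<in> R'" using D_vars by (intro poly_ringI) auto
    then show "evalF x' (monom1 \<beta>) * evalF x' D \<in> R' \<inter> units V"
      using monom[OF \<beta>] D_unit by (simp add: units_mult poly_ring.mult_mem)
  qed (use eq in \<open>simp only: g\<close>)
qed

lemma f'\<^sub>k_unit_multiple:
  obtains v where "v \<in> units V" "f'\<^sub>k = v * f\<^sub>k"
proof -
  obtain a b where quotient: "a \<in> units V" "b \<in> units V" "f'\<^sub>k * b = a * g"
    using f'\<^sub>k_mult_eq by blast
  then have "f'\<^sub>k = (a / b * (g / f\<^sub>k)) * f\<^sub>k"
    using f\<^sub>k_nonzero units_nonzero[OF quotient(2)] by (simp add: field_simps)
  then show ?thesis using that units_mult[OF units_divide[OF quotient(1,2)] g_div_f\<^sub>k_unit] by blast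
qed

lemma z'_k_unit: "z' k \<in> units V" and x_k_eq_z': "x k = z' k * f'\<^sub>k"
proof -
  obtain v where v: "v \<in> units V" "f'\<^sub>k = v * f\<^sub>k" using f'\<^sub>k_unit_multiple by blast
  then have "z' k = z k / v" by (simp add: blowup_def x'_other k)
  then show "z' k \<in> units V" using units_divide[OF z_k_unit v(1)] by simp
  show "x k = z' k * f'\<^sub>k" using v units_nonzero f\<^sub>k_nonzero by (simp add: blowup_def x'_other k)
qed

lemma x_mem_L:
  assumes "l < n"
  shows "x l \<in> L"
proof -
  have "f'\<^sub>k \<in> L"
    using R'_subset_L poly_ringI[OF LP_seed_vars[OF seed' k(1)]] by blast
  then have x_k: "x k \<in> L"
    unfolding x_k_eq_z' by (intro localization.mult_mem localization_var k)
  have other: "x l \<in> L" if "l < n" "l \<noteq> j" for l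
    using that x_k x'_mem_L[of l] x'_other[of l] by (cases "l = k") auto
  then have "f\<^sub>j \<in> L"
    using F\<^sub>j_vars by (intro localization.evalF_mem) auto
  then have "f\<^sub>j / (d * x' j) \<in> L"
    using j k(2) by (intro localization_divide localization.mult_mem units_mult
        d_mem_L d_unit x'_mem_L x'_units) auto
  moreover have "x j = f\<^sub>j / (d * x' j)"
    using units_nonzero d_unit f\<^sub>j_unit x_units[OF j] k(2) by (simp add: x'_j_eq)
  ultimately show ?thesis using other[OF assms] by (cases "l = j") simp_all
qed

lemma z_k_mem_L: "z k \<in> L"
proof -
  obtain t where t: "in_vars n t" "f\<^sub>j ^ N * g = p ^ N * f\<^sub>k + x k * evalF x t"
    using g_congruence by blast
  obtain a b where a: "a \<in> units V" "a \<in> R'"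
    and b: "b \<in> units V" "b \<in> R'" and f'\<^sub>k: "f'\<^sub>k * b = a * g"
    using f'\<^sub>k_mult_eq by blast
  have evalF_mem_L: "evalF x q \<in> L" if "in_vars n q" for q
    using that x_mem_L by (intro localization.evalF_mem) (auto simp: in_vars_def)
  \<comment> \<open>the congruence for g, solved for 1 / z k\<close>
  define e where "e = (f\<^sub>j ^ N * (b / (a * z' k)) - evalF x t) / p ^ N"
  have "b \<in> L" "a \<in> L" using a(2) b(2) R'_subset_L by blast+
  then have e_mem_L: "e \<in> L"
    unfolding e_def
    by (intro localization_divide localization.diff_mem localization.mult_mem localization.power_mem
        localization_var k evalF_mem_L t(1) in_vars_P LP_seed_in_vars[OF seed j]
        units_mult units_power a(1) z'_k_unit p_unit)
  have "x k \<noteq> 0" using x_k_eq_z f\<^sub>k_nonzero units_nonzero[OF z_k_unit] by simp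
  then have "b / (a * z' k) = g / x k"
    using f'\<^sub>k units_nonzero[OF a(1)] units_nonzero[OF z'_k_unit]
    by (auto simp: x_k_eq_z' field_simps)
  then have "f\<^sub>j ^ N * (b / (a * z' k)) = p ^ N * (f\<^sub>k / x k) + evalF x t"
    using t(2) \<open>x k \<noteq> 0\<close> by (simp add: add_divide_distrib)
  then have "e = 1 / z k"
    using f\<^sub>k_nonzero units_nonzero[OF p_unit] by (simp add: e_def x_k_eq_z)
  then have "1 / e \<in> L"
    using e_mem_L units_divide[OF units_one z_k_unit]
    by (intro localization_divide localization.one_mem) simp_all
  then show ?thesis by (simp add: \<open>e = 1 / z k\<close>)
qed

lemma exceptional_preserved_in_vars: "exceptional V n x' F' k"
  using f'\<^sub>k_unit_multiple exceptional_preservedI[OF _ _ z_k_mem_L x_mem_L[OF j]]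
  by blast

end

lemma exceptional_preserved: "exceptional V n x' F' k"
  using exceptional_preserved_notin_vars exceptional_preserved_in_vars by blast

end

section \<open>Clusters determine seeds\<close>

lemma (in discrete_valuation_ring) adapted_mutation:
  assumes "is_LP_seed n (x, F)" "is_LP_seed n (x', F')" "LP_mutation n k (x, F) (x', F')"
    and "k < n" "adapted V n x F"
  shows "adapted V n x' F'"
proof -
  consider (unit) "unit_coordinates V n x" "evalF x (F k) \<in> units V"
    | (nonunit) "unit_coordinates V n x" "evalF x (F k) \<notin> units V"
    | (same) "exceptional V n x F k"
    | (other) l where "l < n" "l \<noteq> k" "exceptional V n x F l"
    using assms(5) by (auto simp: adapted_def)
  then show ?thesis
  proof cases
    case unit
    then have "unit_coordinates V n x'"
      by (rule unit_coordinates_mutation_unit[OF assms(1,3,4)])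
    then show ?thesis by (simp add: adapted_def)
  next
    case nonunit
    then have "exceptional V n x' F' k"
      by (rule unit_coordinates_mutation_nonunit[OF assms(1,3,4)])
    then show ?thesis using assms(4) by (auto simp: adapted_def)
  next
    case same
    then have "unit_coordinates V n x'" by (rule exceptional_mutation_same[OF assms(3,4)])
    then show ?thesis by (simp add: adapted_def)
  next
    case (other l)
    then interpret exceptional_mutation V n k l x x' F F'
      using assms(1-4) by unfold_locales
    show ?thesis using exceptional_preserved other(1) by (auto simp: adapted_def)
  qed
qed

lemma tree_vertex_iff_distinct_adj: "tree_vertex n t \<longleftrightarrow> set t \<subseteq> {..<n} \<and> distinct_adj t"
  by (auto simp: tree_vertex_def distinct_adj_conv_nth)

lemma tree_vertex_snoc:
  "tree_vertex n (t @ [k]) \<longleftrightarrow> tree_vertex n t \<and> k < n \<and> (t = [] \<or> last t \<noteq> k)"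
  by (auto simp: tree_vertex_iff_distinct_adj distinct_adj_append_iff)

lemma tree_vertex_nbr: "tree_vertex n t \<Longrightarrow> k < n \<Longrightarrow> tree_vertex n (tree_nbr k t)"
  by (cases t rule: rev_cases)
    (auto simp: tree_nbr_def tree_vertex_iff_distinct_adj distinct_adj_append_iff)

lemma tree_vertex_connected:
  assumes "tree_vertex n s" "tree_vertex n t" "P s"
    and step: "\<And>t k. tree_vertex n t \<Longrightarrow> k < n \<Longrightarrow> P t \<Longrightarrow> P (tree_nbr k t)"
  shows "P t"
proof -
  have "P []"
    using assms(1,3)
  proof (induction s rule: rev_induct)
    case (snoc k s)
    then show ?case using step[of "s @ [k]" k] by (simp add: tree_nbr_def tree_vertex_snoc)
  qed
  show ?thesis
    using assms(2)
  proof (induction t rule: rev_induct)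
    case (snoc k t)
    then show ?case using step[of t k] by (auto simp: tree_nbr_def tree_vertex_snoc)
  qed (rule \<open>P []\<close>)
qed

lemma (in discrete_valuation_ring) adapted_LP_pattern:
  assumes "LP_pattern n \<Sigma>" "tree_vertex n s" "tree_vertex n t"
    and "adapted V n (fst (\<Sigma> s)) (snd (\<Sigma> s))"
  shows "adapted V n (fst (\<Sigma> t)) (snd (\<Sigma> t))"
proof (rule tree_vertex_connected[OF assms(2,3),
      where P = "\<lambda>t. adapted V n (fst (\<Sigma> t)) (snd (\<Sigma> t))"])
  fix t k assume t: "tree_vertex n t" "k < n" "adapted V n (fst (\<Sigma> t)) (snd (\<Sigma> t))"
  show "adapted V n (fst (\<Sigma> (tree_nbr k t))) (snd (\<Sigma> (tree_nbr k t)))"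
    using assms(1) t(1,2) tree_vertex_nbr[OF t(1,2)]
    by (intro adapted_mutation[OF _ _ _ t(2,3)]) (simp_all add: LP_pattern_def)
qed (rule assms(4))

lemma poly_ring_mono: "A \<subseteq> B \<Longrightarrow> poly_ring A x \<subseteq> poly_ring B x"
  by (auto simp: poly_ring_def)

lemma poly_ring_reindex:
  assumes \<sigma>: "bij_betw \<sigma> A B"
    and y: "\<And>l. l \<in> A \<Longrightarrow> r l dvd 1" "\<And>l. l \<in> A \<Longrightarrow> y l = to_fr (Const (r l)) * x (\<sigma> l)"
  shows "poly_ring A y = poly_ring B x"
proof
  show "poly_ring A y \<subseteq> poly_ring B x"
  proof (rule poly_ring.poly_ring_subset)
    fix l assume l: "l \<in> A"
    then have "\<sigma> l \<in> B" using \<sigma> by (auto dest: bij_betwE)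
    then show "y l \<in> poly_ring B x"
      unfolding y(2)[OF l] by (intro poly_ring.mult_mem poly_ring.const_mem poly_ring_var)
  qed
  show "poly_ring B x \<subseteq> poly_ring A y"
  proof (rule poly_ring.poly_ring_subset)
    fix m assume "m \<in> B"
    then obtain l where l: "l \<in> A" "m = \<sigma> l" using \<sigma> by (auto simp: bij_betw_def)
    note unit = poly_ring.units_const[OF y(1)[OF l(1)], of A y]
    have "x m = y l / to_fr (Const (r l))"
      using poly_ring.units_nonzero[OF unit] by (simp add: y(2)[OF l(1)] l(2))
    also have "\<dots> \<in> poly_ring A y" by (intro poly_ring.divide_units_mem poly_ring_var l unit)
    finally show "x m \<in> poly_ring A y" .
  qed
qed

lemma (in discrete_valuation_ring) exceptional_exchange_polys_associated:
  assumes S\<^sub>1: "is_LP_seed n (x\<^sub>1, F\<^sub>1)" and k: "k < n" and exc\<^sub>1: "exceptional V n x\<^sub>1 F\<^sub>1 k"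
    and S\<^sub>2: "is_LP_seed n (x\<^sub>2, F\<^sub>2)" and i: "i < n" and exc\<^sub>2: "exceptional V n x\<^sub>2 F\<^sub>2 i"
    and ring_eq: "poly_ring ({..<n} - {i}) x\<^sub>2 = poly_ring ({..<n} - {k}) x\<^sub>1"
  obtains u where "u dvd 1" "evalF x\<^sub>2 (F\<^sub>2 i) = to_fr (Const u) * evalF x\<^sub>1 (F\<^sub>1 k)"
proof -
  let ?f\<^sub>1 = "evalF x\<^sub>1 (F\<^sub>1 k)" and ?f\<^sub>2 = "evalF x\<^sub>2 (F\<^sub>2 i)"
  let ?R = "poly_ring ({..<n} - {k}) x\<^sub>1"
  have nonzero: "?f\<^sub>1 \<noteq> 0" "?f\<^sub>2 \<noteq> 0"
    using LP_seed_evalF_nonzero S\<^sub>1 k S\<^sub>2 i by blast+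
  have "?f\<^sub>1 \<in> ?R" "?f\<^sub>2 \<in> ?R"
    using poly_ringI[OF LP_seed_vars[OF S\<^sub>1 k]] poly_ringI[OF LP_seed_vars[OF S\<^sub>2 i], of x\<^sub>2]
    by (simp_all add: ring_eq)
  then have "?f\<^sub>2 / ?f\<^sub>1 \<in> ?R" "?f\<^sub>1 / ?f\<^sub>2 \<in> ?R"
    using exceptional_divide_mem_poly_ring[OF S\<^sub>1 k exc\<^sub>1 _ exceptional_nonunit[OF exc\<^sub>2]]
      exceptional_divide_mem_poly_ring[OF S\<^sub>2 i exc\<^sub>2 _ exceptional_nonunit[OF exc\<^sub>1]]
    by (simp_all add: ring_eq)
  then have "?f\<^sub>2 / ?f\<^sub>1 \<in> units (poly_ring {..<n} x\<^sub>1)"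
    using nonzero poly_ring_mono[of "{..<n} - {k}" "{..<n}" x\<^sub>1] by (auto simp: units_def)
  then obtain u where "u dvd 1" "?f\<^sub>2 / ?f\<^sub>1 = to_fr (Const u)"
    by (rule poly_ring_unit[OF LP_seed_alg_indep[OF S\<^sub>1]])
  then show ?thesis using that nonzero by (simp add: field_simps)
qed

theorem theorem3p1:
  fixes n :: nat
    and \<Sigma> :: "nat list \<Rightarrow> 'a::{factorial_semiring,idom,ring_char_0} seed"
    and t1 t2 :: "nat list" and \<sigma> :: "nat \<Rightarrow> nat" and r :: "nat \<Rightarrow> 'a"
  assumes "n \<ge> 1"
    and "LP_pattern n \<Sigma>"
    and "tree_vertex n t1" and "tree_vertex n t2"
    and "bij_betw \<sigma> {..<n} {..<n}"
    and "\<forall>i<n. is_unit (r i) \<and> fst (\<Sigma> t2) i = to_fr (Const (r i)) * fst (\<Sigma> t1) (\<sigma> i)"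
  shows "\<forall>i<n. \<exists>r'. is_unit r' \<and>
           evalF (fst (\<Sigma> t2)) (snd (\<Sigma> t2) i) =
           to_fr (Const r') * evalF (fst (\<Sigma> t1)) (snd (\<Sigma> t1) (\<sigma> i))"
proof (intro allI impI)
  fix i assume i: "i < n"
  obtain x\<^sub>1 F\<^sub>1 x\<^sub>2 F\<^sub>2 where \<Sigma>: "\<Sigma> t1 = (x\<^sub>1, F\<^sub>1)" "\<Sigma> t2 = (x\<^sub>2, F\<^sub>2)" by (metis surj_pair)
  have S\<^sub>1: "is_LP_seed n (x\<^sub>1, F\<^sub>1)" and S\<^sub>2: "is_LP_seed n (x\<^sub>2, F\<^sub>2)"
    using assms(2-4) \<Sigma> by (metis LP_pattern_def)+
  have k: "\<sigma> i < n" using assms(5) i by (auto dest: bij_betwE)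
  have r: "r l dvd 1" "x\<^sub>2 l = to_fr (Const (r l)) * x\<^sub>1 (\<sigma> l)" if "l < n" for l
    using assms(6) that by (simp_all add: \<Sigma>)
  obtain V where "discrete_valuation_ring V" and exc\<^sub>1: "exceptional V n x\<^sub>1 F\<^sub>1 (\<sigma> i)"
    by (rule LP_seed_exceptional_exists[OF S\<^sub>1 k])
  then interpret discrete_valuation_ring V by simp
  have "adapted V n x\<^sub>1 F\<^sub>1" using exc\<^sub>1 k by (auto simp: adapted_def)
  then have "adapted V n x\<^sub>2 F\<^sub>2" using adapted_LP_pattern[OF assms(2-4)] by (simp add: \<Sigma>)
  moreover have "x\<^sub>2 i \<notin> units V"
    using exceptional_var_nonunit[OF exc\<^sub>1 k] units_const[OF r(1)[OF i]] units_mult_cancel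
    by (simp add: r(2)[OF i])
  ultimately have exc\<^sub>2: "exceptional V n x\<^sub>2 F\<^sub>2 i" by (intro adapted_imp_exceptional i)
  have "bij_betw \<sigma> ({..<n} - {i}) ({..<n} - {\<sigma> i})"
    using assms(5) i k by (intro bij_betw_DiffI) auto
  then have "poly_ring ({..<n} - {i}) x\<^sub>2 = poly_ring ({..<n} - {\<sigma> i}) x\<^sub>1"
    by (rule poly_ring_reindex[where r = r]) (simp_all add: r)
  then show "\<exists>r'. is_unit r' \<and> evalF (fst (\<Sigma> t2)) (snd (\<Sigma> t2) i) =
      to_fr (Const r') * evalF (fst (\<Sigma> t1)) (snd (\<Sigma> t1) (\<sigma> i))"
    using exceptional_exchange_polys_associated[OF S\<^sub>1 k exc\<^sub>1 S\<^sub>2 i exc\<^sub>2] by (auto simp: \<Sigma>)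
qed

end
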